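(* Let $\tau$ be a transportation cost and let $\mu_+,\mu_-$ be nonnegative finite Borel measures on $\mathbb{R}^n$ with bounded support. Then either the minimization problem $\min_{\mathcal F\in\mathrm{rca}(\mathbb{R}^n;\mathbb{R}^n)} J^{\tau,\mu_+,\mu_-}[\mathcal F]$ has a solution (i.e. the infimum is attained), or $J^{\tau,\mu_+,\mu_-}[\mathcal F]=+\infty$ for every $\mathcal F$.
   Context: A transportation cost is a function $\tau:[0,\infty)\to[0,\infty)$ with $\tau(0)=0$, $\tau(w)>0$ for $w>0$, which is non-decreasing, subadditive and lower semi-continuous. $\mathrm{rca}(\mathbb{R}^n;\mathbb{R}^n)$ denotes the $\mathbb{R}^n$-valued finite (regular, countably additive) Borel measures on $\mathbb{R}^n$; $\rightharpoonup^*$ denotes weak-* convergence of measures. A discrete finite mass is a measure $\sum_{i=1}^k a_i\delta_{x_i}$ with $k\in\mathbb N$, $a_i>0$, $x_i\in\mathbb{R}^n$. Given discrete finite masses $\mu_+,\mu_-$ of equal total mass, a discrete mass flux between them is a finite weighted directed graph $G$ with vertex set $V(G)$, a set $E(G)$ of straight oriented segments (edges) $e$ with initial point $e^+$ and final point $e^-$, and weights $w:E(G)\to[0,\infty)$, such that for every $v\in V(G)\cup\operatorname{spt}\mu_+\cup\operatorname{spt}\mu_-$: $\mu_+(\{v\})+\sum_{e:\,e^-=v}w(e)=\mu_-(\{v\})+\sum_{e:\,e^+=v}w(e)$. Its flux is $\mathcal F_G=\sum_{e\in E(G)}w(e)\,\hat e\,\mathcal H^1\llcorner e$ with $\hat e=(e^--e^+)/|e^--e^+|$,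 and its cost is $J^\tau(G)=\sum_{e\in E(G)}\tau(w(e))\,\ell(e)$, $\ell(e)$ the length of $e$. For nonnegative finite Borel measures $\mu_\pm$ and $\mathcal F\in\mathrm{rca}(\mathbb{R}^n;\mathbb{R}^n)$, an approximating graph sequence for $(\mu_+,\mu_-,\mathcal F)$ is a sequence of discrete finite masses $\mu_\pm^k$ and discrete mass fluxes $G_k$ between $\mu_+^k$ and $\mu_-^k$ with $\mu_+^k\rightharpoonup^*\mu_+$, $\mu_-^k\rightharpoonup^*\mu_-$, $\mathcal F_{G_k}\rightharpoonup^*\mathcal F$. Define $J^{\tau,\mu_+,\mu_-}[\mathcal F]=\inf\{\liminf_{k\to\infty}J^\tau(G_k)\}$, the infimum over all approximating graph sequences for $(\mu_+,\mu_-,\mathcal F)$ (equal to $+\infty$ if there is none). *)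

theory Defs
  imports "HOL-Analysis.Analysis"
begin

definition transportation_cost :: "(real \<Rightarrow> real) \<Rightarrow> bool" where
  "transportation_cost \<tau> \<longleftrightarrow>
     \<tau> 0 = 0 \<and>
     (\<forall>w\<ge>0. \<tau> w \<ge> 0) \<and>
     (\<forall>w>0. \<tau> w > 0) \<and>
     (\<forall>v w. 0 \<le> v \<and> v \<le> w \<longrightarrow> \<tau> v \<le> \<tau> w) \<and>
     (\<forall>v w. 0 \<le> v \<and> 0 \<le> w \<longrightarrow> \<tau> (v + w) \<le> \<tau> v + \<tau> w) \<and>
     (\<forall>w\<ge>0. \<forall>e>0. \<exists>d>0. \<forall>v\<ge>0. \<bar>v - w\<bar> < d \<longrightarrow> \<tau> w - e < \<tau> v)"

definition spt :: "'a::metric_space measure \<Rightarrow> 'a set" where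
  "spt \<mu> = {x. \<forall>r>0. emeasure \<mu> (ball x r) > 0}"

text \<open>Test functions for weak-* convergence: C_0(R^n), the predual of rca.\<close>
definition C0 :: "('a::euclidean_space \<Rightarrow> real) \<Rightarrow> bool" where
  "C0 \<phi> \<longleftrightarrow> continuous_on UNIV \<phi> \<and>
      (\<forall>e>0. \<exists>R. \<forall>x. R \<le> norm x \<longrightarrow> \<bar>\<phi> x\<bar> \<le> e)"

definition is_rca :: "('a::euclidean_space set \<Rightarrow> 'a) \<Rightarrow> bool" where
  "is_rca F \<longleftrightarrow> F {} = 0 \<and>
     (\<forall>A::nat \<Rightarrow> 'a set. range A \<subseteq> sets borel \<longrightarrow> disjoint_family A \<longrightarrow>
         (\<lambda>i. F (A i)) sums F (\<Union>i. A i))"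

text \<open>Positive and negative variation of the component of F along the basis vector b
  (Jordan decomposition).\<close>
definition comp_pos :: "('a::euclidean_space set \<Rightarrow> 'a) \<Rightarrow> 'a \<Rightarrow> 'a measure" where
  "comp_pos F b = measure_of UNIV (sets borel)
      (\<lambda>A. ennreal (Sup ((\<lambda>B. F B \<bullet> b) ` {B \<in> sets borel. B \<subseteq> A})))"

definition comp_neg :: "('a::euclidean_space set \<Rightarrow> 'a) \<Rightarrow> 'a \<Rightarrow> 'a measure" where
  "comp_neg F b = measure_of UNIV (sets borel)
      (\<lambda>A. ennreal (Sup ((\<lambda>B. - (F B \<bullet> b)) ` {B \<in> sets borel. B \<subseteq> A})))"

definition vint :: "('a::euclidean_space set \<Rightarrow> 'a) \<Rightarrow> ('a \<Rightarrow> real) \<Rightarrow> 'a" where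
  "vint F \<phi> = (\<Sum>b\<in>Basis.
      ((\<integral>x. \<phi> x \<partial>comp_pos F b) - (\<integral>x. \<phi> x \<partial>comp_neg F b)) *\<^sub>R b)"

definition vec_wconv :: "(nat \<Rightarrow> 'a::euclidean_space set \<Rightarrow> 'a) \<Rightarrow> ('a set \<Rightarrow> 'a) \<Rightarrow> bool" where
  "vec_wconv Fk F \<longleftrightarrow> (\<forall>\<phi>. C0 \<phi> \<longrightarrow> (\<lambda>k. vint (Fk k) \<phi>) \<longlonglongrightarrow> vint F \<phi>)"

text \<open>A discrete finite mass \<Sum> a_i \<delta>_{x_i} is represented by its finitely supported,
  nonnegative density m with respect to counting measure: m x = mass at x.\<close>
definition discrete_mass :: "('a \<Rightarrow> real) \<Rightarrow> bool" where
  "discrete_mass m \<longleftrightarrow> (\<forall>x. 0 \<le> m x) \<and> finite {x. m x \<noteq> 0}"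

definition total_mass :: "('a \<Rightarrow> real) \<Rightarrow> real" where
  "total_mass m = (\<Sum>x\<in>{x. m x \<noteq> 0}. m x)"

definition mass_wconv :: "(nat \<Rightarrow> 'a::euclidean_space \<Rightarrow> real) \<Rightarrow> 'a measure \<Rightarrow> bool" where
  "mass_wconv mk \<mu> \<longleftrightarrow> (\<forall>\<phi>. C0 \<phi> \<longrightarrow>
      (\<lambda>k. \<Sum>x\<in>{x. mk k x \<noteq> 0}. mk k x * \<phi> x) \<longlonglongrightarrow> (\<integral>x. \<phi> x \<partial>\<mu>))"

text \<open>A graph is (V, E, w): an edge e is a pair (e^+, e^-) = (fst e, snd e) of
  (initial point, final point), representing the oriented segment from e^+ to e^-.\<close>
definition mass_flux ::
  "('a::euclidean_space \<Rightarrow> real) \<Rightarrow> ('a \<Rightarrow> real) \<Rightarrow> 'a set \<Rightarrow> ('a \<times> 'a) set \<Rightarrow> ('a \<times> 'a \<Rightarrow> real) \<Rightarrow> bool" where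
  "mass_flux mp mm V E w \<longleftrightarrow>
     discrete_mass mp \<and> discrete_mass mm \<and> total_mass mp = total_mass mm \<and>
     finite V \<and> finite E \<and>
     (\<forall>e\<in>E. fst e \<in> V \<and> snd e \<in> V \<and> fst e \<noteq> snd e) \<and>
     (\<forall>e\<in>E. 0 \<le> w e) \<and>
     (\<forall>v \<in> V \<union> {x. mp x \<noteq> 0} \<union> {x. mm x \<noteq> 0}.
        mp v + (\<Sum>e\<in>{e\<in>E. snd e = v}. w e) = mm v + (\<Sum>e\<in>{e\<in>E. fst e = v}. w e))"

text \<open>Flux F_G(A) = \<Sum>_e w(e) \<hat>e H^1(A \<inter> e); H^1 restricted to the segment e is
  the pushforward of (length e) times Lebesgue measure on [0,1] under the affine parametrisation.\<close>
definition graph_flux :: "('a::euclidean_space \<times> 'a) set \<Rightarrow> ('a \<times> 'a \<Rightarrow> real) \<Rightarrow> 'a set \<Rightarrow> 'a" where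
  "graph_flux E w A = (\<Sum>e\<in>E. (w e * measure lborel {t::real. 0 \<le> t \<and> t \<le> 1 \<and>
        fst e + t *\<^sub>R (snd e - fst e) \<in> A}) *\<^sub>R (snd e - fst e))"

definition graph_cost :: "(real \<Rightarrow> real) \<Rightarrow> ('a::metric_space \<times> 'a) set \<Rightarrow> ('a \<times> 'a \<Rightarrow> real) \<Rightarrow> real" where
  "graph_cost \<tau> E w = (\<Sum>e\<in>E. \<tau> (w e) * dist (fst e) (snd e))"

definition Jfun :: "(real \<Rightarrow> real) \<Rightarrow> 'a::euclidean_space measure \<Rightarrow> 'a measure \<Rightarrow> ('a set \<Rightarrow> 'a) \<Rightarrow> ereal" where
  "Jfun \<tau> \<mu>p \<mu>m F = Inf {liminf (\<lambda>k. ereal (graph_cost \<tau> (E k) (w k))) | mp mm V E w.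
      (\<forall>k. mass_flux (mp k) (mm k) (V k) (E k) (w k)) \<and>
      mass_wconv mp \<mu>p \<and> mass_wconv mm \<mu>m \<and>
      vec_wconv (\<lambda>k. graph_flux (E k) (w k)) F}"

end

theory Submission
  imports Defs "HOL-Probability.Helly_Selection" "HOL-Probability.Giry_Monad"
begin

text \<open>Take a minimizing sequence of fluxes and approximating graphs for each of them. A 1-Lipschitz
  map of the space transports a graph without increasing its cost. The map used here is the identity
  on a large ball and collapses everything far away to one point, whose distance from the origin
  tends to infinity along the sequence; common mass of source and sink at that point cancels.
  Hence the total masses stay bounded although weak-* convergence allows mass to escape, and removing
  cycles bounds the edge weights by the total mass. As a transportation cost dominates a positive
  multiple of the weight on bounded intervals, the total variations of the fluxes are bounded, and a
  diagonal sequence of graphs has a weak-* convergent subsequence, whose limit is a minimizer.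

  Weak-* compactness of measures is reduced to Helly's selection theorem on the real line by lifting
  measures along Schoenberg's space-filling curve.\<close>

section \<open>Discrete mass fluxes\<close>

text \<open>The test functions vanish at infinity, so masses approximating a finite measure may have
  total mass tending to infinity, and then no bound on the edge weights is available. On unbounded
  weights a bounded \<open>\<tau>\<close>, say, controls no total variation: an edge may carry
  arbitrarily much at bounded cost. Projection onto a large ball is 1-Lipschitz as well, but it
  would spread the outer mass over a sphere, where sources and sinks need not meet. Folding the
  outside to a single point makes them meet. By conservation, the outer masses of source and sink
  differ by exactly as much as the inner ones, and the inner ones are bounded because a cutoff
  function tests them. After cancellation a bounded lump remains, and it is invisible in the limit
  because its position leaves every compact set. Between the region that the map fixes and the
  region that it collapses lies a shell where points move. Its mass becomes negligible, since the
  limit measure is finite and the shells move to infinity; the choice of the graph at each stage has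
  to enforce this too.\<close>

definition msum :: "('a \<Rightarrow> real) \<Rightarrow> ('a \<Rightarrow> real) \<Rightarrow> real" where
  "msum m f = (\<Sum>x\<in>{x. m x \<noteq> 0}. m x * f x)"

lemma msum_superset:
  "finite S \<Longrightarrow> {x. m x \<noteq> 0} \<subseteq> S \<Longrightarrow> msum m f = (\<Sum>x\<in>S. m x * f x)"
  unfolding msum_def by (intro sum.mono_neutral_left) auto

lemma total_mass_eq_msum: "total_mass m = msum m (\<lambda>_. 1)"
  by (simp add: total_mass_def msum_def)

lemma msum_nonneg: "discrete_mass m \<Longrightarrow> (\<And>x. 0 \<le> f x) \<Longrightarrow> 0 \<le> msum m f"
  unfolding msum_def discrete_mass_def by (intro sum_nonneg) auto

lemma msum_mono: "discrete_mass m \<Longrightarrow> (\<And>x. f x \<le> g x) \<Longrightarrow> msum m f \<le> msum m g"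
  unfolding msum_def discrete_mass_def by (intro sum_mono mult_left_mono) auto

lemma msum_add: "msum m (\<lambda>x. f x + g x) = msum m f + msum m g"
  by (simp add: msum_def algebra_simps sum.distrib)

lemma msum_diff: "msum m (\<lambda>x. f x - g x) = msum m f - msum m g"
  by (simp add: msum_def algebra_simps sum_subtractf)

lemma msum_cmult: "msum m (\<lambda>x. c * f x) = c * msum m f"
  by (simp add: msum_def sum_distrib_left algebra_simps)

lemma msum_sum: "msum m (\<lambda>x. \<Sum>i\<in>I. f i x) = (\<Sum>i\<in>I. msum m (f i))"
  unfolding msum_def sum_distrib_left by (rule sum.swap)

lemma abs_msum_le: "discrete_mass m \<Longrightarrow> \<bar>msum m f\<bar> \<le> msum m (\<lambda>x. \<bar>f x\<bar>)"
  unfolding msum_def discrete_mass_def by (intro order_trans[OF sum_abs]) (auto simp: abs_mult)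

lemma msum_indicator_singleton:
  assumes "discrete_mass m" shows "msum m (indicator {v}) = m v"
proof -
  have "msum m (indicator {v}) = (\<Sum>x\<in>insert v {x. m x \<noteq> 0}. m x * indicator {v} x)"
    using assms by (intro msum_superset) (auto simp: discrete_mass_def)
  also have "\<dots> = m v"
    using assms by (subst sum.remove[of _ v]) (auto simp: discrete_mass_def intro!: sum.neutral)
  finally show ?thesis .
qed

text \<open>In this weak form the Kirchhoff conditions are stable under push-forward.\<close>

lemma mass_flux_divergence:
  assumes "mass_flux mp mm V E w"
  shows "msum mm f = msum mp f + (\<Sum>e\<in>E. w e * (f (snd e) - f (fst e)))"
proof -
  define S where "S = V \<union> {x. mp x \<noteq> 0} \<union> {x. mm x \<noteq> 0}"
  have fin: "finite S" "finite E" and VE: "\<And>e. e \<in> E \<Longrightarrow> fst e \<in> S \<and> snd e \<in> S"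
    using assms by (auto simp: mass_flux_def discrete_mass_def S_def)
  have bal: "mp v + (\<Sum>e\<in>{e\<in>E. snd e = v}. w e) = mm v + (\<Sum>e\<in>{e\<in>E. fst e = v}. w e)" if "v \<in> S" for v
    using assms that by (simp add: mass_flux_def S_def)
  \<comment> \<open>Regrouping of the edges by one endpoint. Applied to heads and to tails, it
    amounts to summation by parts on the graph.\<close>
  have gr: "(\<Sum>v\<in>S. f v * (\<Sum>e\<in>{e\<in>E. h e = v}. w e)) = (\<Sum>e\<in>E. w e * f (h e))"
    if "h ` E \<subseteq> S" for h
  proof -
    have "(\<Sum>v\<in>S. f v * (\<Sum>e\<in>{e\<in>E. h e = v}. w e)) = (\<Sum>v\<in>S. \<Sum>e\<in>{e\<in>E. h e = v}. w e * f (h e))"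
      by (intro sum.cong refl) (auto simp: sum_distrib_left mult.commute)
    also have "\<dots> = (\<Sum>e\<in>E. w e * f (h e))"
      using fin that by (intro sum.group)
    finally show ?thesis .
  qed
  have "(\<Sum>v\<in>S. f v * (mp v + (\<Sum>e\<in>{e\<in>E. snd e = v}. w e))) =
        (\<Sum>v\<in>S. f v * (mm v + (\<Sum>e\<in>{e\<in>E. fst e = v}. w e)))"
    by (intro sum.cong refl) (simp add: bal)
  moreover have "msum mp f = (\<Sum>v\<in>S. f v * mp v)" "msum mm f = (\<Sum>v\<in>S. f v * mm v)"
    using msum_superset[OF fin(1), of mp f] msum_superset[OF fin(1), of mm f]
    by (auto simp: S_def mult.commute)
  ultimately show ?thesis
    using gr[of fst] gr[of snd] VE
    by (auto simp: distrib_left sum.distrib sum_subtractf right_diff_distrib image_subset_iff)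
qed

text \<open>Testing with the constant 1 yields equal total masses, and testing with the indicator of
  a point yields Kirchhoff's condition at that point. The weak form therefore characterises fluxes,
  and later constructions only have to verify it.\<close>

lemma mass_fluxI:
  assumes "discrete_mass mp" "discrete_mass mm" "finite V" "finite E"
    and "\<And>e. e \<in> E \<Longrightarrow> fst e \<in> V \<and> snd e \<in> V \<and> fst e \<noteq> snd e" and "\<And>e. e \<in> E \<Longrightarrow> 0 \<le> w e"
    and div: "\<And>f. msum mm f = msum mp f + (\<Sum>e\<in>E. w e * (f (snd e) - f (fst e)))"
  shows "mass_flux mp mm V E w"
proof -
  have "total_mass mp = total_mass mm"
    using div[of "\<lambda>_. 1"] by (simp add: total_mass_eq_msum)
  moreover have "mp v + (\<Sum>e\<in>{e\<in>E. snd e = v}. w e) = mm v + (\<Sum>e\<in>{e\<in>E. fst e = v}. w e)" for v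
  proof -
    have eq: "(\<Sum>e\<in>E. w e * indicator {v} (h e)) = (\<Sum>e\<in>{e\<in>E. h e = v}. w e)" for h :: "'a \<times> 'a \<Rightarrow> 'a"
      unfolding sum.inter_filter[OF assms(4)] by (intro sum.cong) auto
    show ?thesis
      using div[of "indicator {v}"] assms(1,2)
      by (simp add: msum_indicator_singleton right_diff_distrib sum_subtractf eq)
  qed
  ultimately show ?thesis using assms unfolding mass_flux_def by auto
qed

lemma mass_fluxD:
  assumes "mass_flux mp mm V E w"
  shows "discrete_mass mp" "discrete_mass mm" "finite V" "finite E" "\<And>e. e \<in> E \<Longrightarrow> 0 \<le> w e"
    "\<And>e. e \<in> E \<Longrightarrow> fst e \<in> V \<and> snd e \<in> V \<and> fst e \<noteq> snd e"
  using assms by (auto simp: mass_flux_def)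

section \<open>Subadditivity and linear lower bounds of transportation costs\<close>

lemma transportation_costD:
  assumes "transportation_cost \<tau>"
  shows "\<tau> 0 = 0" "\<And>w. 0 \<le> w \<Longrightarrow> 0 \<le> \<tau> w" "\<And>w. 0 < w \<Longrightarrow> 0 < \<tau> w"
    "\<And>v w. 0 \<le> v \<Longrightarrow> v \<le> w \<Longrightarrow> \<tau> v \<le> \<tau> w"
    "\<And>v w. 0 \<le> v \<Longrightarrow> 0 \<le> w \<Longrightarrow> \<tau> (v + w) \<le> \<tau> v + \<tau> w"
  using assms by (auto simp: transportation_cost_def)

lemma transportation_cost_sum:
  assumes "transportation_cost \<tau>" "finite I" "\<And>i. i \<in> I \<Longrightarrow> 0 \<le> w i"
  shows "\<tau> (\<Sum>i\<in>I. w i) \<le> (\<Sum>i\<in>I. \<tau> (w i))"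
  using assms(2,3)
proof (induction I rule: finite_induct)
  case empty
  then show ?case using transportation_costD(1)[OF assms(1)] by simp
next
  case (insert i I)
  have "\<tau> (w i + (\<Sum>i\<in>I. w i)) \<le> \<tau> (w i) + \<tau> (\<Sum>i\<in>I. w i)"
    using insert by (intro transportation_costD[OF assms(1)] sum_nonneg) auto
  then show ?case using insert by force
qed

text \<open>By subadditivity and monotonicity, \<open>n = \<lceil>M / w\<rceil>\<close> portions of
  size \<open>w\<close> cost at least \<open>\<tau> M\<close>, and \<open>n \<le> 2 * M / w\<close>
  because \<open>w \<le> M\<close>. Hence the slope \<open>\<tau> M / (2 * M)\<close>. For bounded
  \<open>\<tau>\<close> it tends to 0 as \<open>M\<close> grows, which is why the weights have to be
  bounded before the total variation can be.\<close>

lemma transportation_cost_linear_lower_bound: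
  assumes "transportation_cost \<tau>" "M > 0"
  obtains l where "l > 0" "\<And>w. 0 \<le> w \<Longrightarrow> w \<le> M \<Longrightarrow> l * w \<le> \<tau> w"
proof -
  note \<tau> = transportation_costD[OF assms(1)]
  have "\<tau> M / (2 * M) * w \<le> \<tau> w" if w: "0 \<le> w" "w \<le> M" for w
  proof (cases "w = 0")
    case True
    then show ?thesis using \<tau>(1) by simp
  next
    case False
    then have w0: "w > 0" using w by simp
    define n where "n = nat \<lceil>M / w\<rceil>"
    have "M / w \<le> real n" unfolding n_def by linarith
    moreover have "real n \<le> M / w + 1"
      using w0 assms(2) unfolding n_def by (simp add: of_nat_nat)
    moreover have "1 \<le> M / w" using w0 w by simp
    ultimately have n: "M \<le> real n * w" "real n \<le> 2 * M / w" using w0 by (auto simp: field_simps)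
    have "\<tau> M \<le> \<tau> (\<Sum>i<n. w)" using n assms(2) by (intro \<tau>(4)) auto
    also have "\<dots> \<le> (\<Sum>i<n. \<tau> w)" using w by (intro transportation_cost_sum assms) auto
    also have "\<dots> = real n * \<tau> w" by simp
    also have "\<dots> \<le> 2 * M / w * \<tau> w" using n \<tau>(2)[OF w(1)] by (intro mult_right_mono)
    finally show ?thesis using w0 assms(2) by (simp add: field_simps)
  qed
  moreover have "\<tau> M / (2 * M) > 0" using \<tau>(3) assms(2) by simp
  ultimately show ?thesis using that by blast
qed

lemma graph_cost_mono:
  assumes "transportation_cost \<tau>" "\<And>e. e \<in> E \<Longrightarrow> 0 \<le> w' e \<and> w' e \<le> w e"
  shows "graph_cost \<tau> E w' \<le> graph_cost \<tau> E w"
  unfolding graph_cost_def using assms(2)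
  by (intro sum_mono mult_right_mono transportation_costD(4)[OF assms(1)]) auto

text \<open>Among all subflows with the same divergence, one with the fewest active edges carries no
  cycle; comparing masses across the set reachable from the head of an edge then bounds its weight
  by the total mass.\<close>

lemma mass_flux_reduce:
  assumes flux: "mass_flux mp mm V E w"
  obtains w' where "mass_flux mp mm V E w'" "\<And>e. e \<in> E \<Longrightarrow> w' e \<le> w e"
    "\<And>e. e \<in> E \<Longrightarrow> w' e \<le> total_mass mp"
proof -
  define adm where "adm u \<longleftrightarrow> mass_flux mp mm V E u \<and> (\<forall>e\<in>E. u e \<le> w e)" for u
  define act where "act u = {e \<in> E. u e > 0}" for u :: "'a \<times> 'a \<Rightarrow> real"
  have "adm w" using flux by (simp add: adm_def)
  \<comment> \<open>Minimising a number of edges needs no compactness: a least element exists by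
    well-ordering.\<close>
  from ex_has_least_nat[of adm, OF this, of "\<lambda>u. card (act u)"]
  obtain u where u: "adm u" and least: "\<And>v. adm v \<Longrightarrow> card (act u) \<le> card (act v)"
    by blast
  have uflux: "mass_flux mp mm V E u" and uw: "\<And>e. e \<in> E \<Longrightarrow> u e \<le> w e"
    using u by (auto simp: adm_def)
  note uD = mass_fluxD[OF uflux]
  have finE: "finite E" by (rule uD)
  \<comment> \<open>A circulation on active edges can be subtracted without changing the divergence.
    Here \<open>t\<close> is the largest multiple that keeps all weights nonnegative; it
    extinguishes the edge \<open>e1\<close> and activates none, against minimality.\<close>
  have no_cycle: False
    if c: "\<And>e. e \<in> E \<Longrightarrow> 0 \<le> c e" "\<And>e. e \<in> E \<Longrightarrow> c e > 0 \<Longrightarrow> u e > 0"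
      and pos: "\<exists>e\<in>E. c e > 0"
      and circ: "\<And>f. (\<Sum>e\<in>E. c e * (f (snd e) - f (fst e))) = (0::real)" for c
  proof -
    define T where "T = {e \<in> E. c e > 0}"
    define t where "t = Min ((\<lambda>e. u e / c e) ` T)"
    have T: "finite T" "T \<noteq> {}" using finE pos by (auto simp: T_def)
    have t_le: "t \<le> u e / c e" if "e \<in> T" for e
      unfolding t_def using T that by (intro Min_le) auto
    have "t \<in> (\<lambda>e. u e / c e) ` T" unfolding t_def using T by (intro Min_in) auto
    then obtain e1 where e1: "e1 \<in> T" "t = u e1 / c e1" by auto
    have t0: "t > 0" using e1 c by (simp add: T_def)
    define v where "v e = u e - t * c e" for e
    have v0: "0 \<le> v e" if "e \<in> E" for e
    proof (cases "e \<in> T")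
      case True
      then show ?thesis using t_le[OF True] by (simp add: v_def T_def field_simps)
    next
      case False
      then have "c e = 0" using c(1)[OF that] that by (auto simp: T_def)
      then show ?thesis using uD(5)[OF that] by (simp add: v_def)
    qed
    have vu: "v e \<le> u e" if "e \<in> E" for e using t0 c(1)[OF that] by (simp add: v_def)
    have "mass_flux mp mm V E v"
    proof (rule mass_fluxI)
      fix f :: "'a \<Rightarrow> real"
      have "(\<Sum>e\<in>E. v e * (f (snd e) - f (fst e))) =
        (\<Sum>e\<in>E. u e * (f (snd e) - f (fst e))) - t * (\<Sum>e\<in>E. c e * (f (snd e) - f (fst e)))"
        by (simp add: v_def left_diff_distrib sum_subtractf sum_distrib_left mult.assoc)
      then show "msum mm f = msum mp f + (\<Sum>e\<in>E. v e * (f (snd e) - f (fst e)))"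
        using mass_flux_divergence[OF uflux, of f] circ[of f] by simp
    qed (use uD v0 in auto)
    then have "adm v" using vu uw by (force simp: adm_def)
    moreover have "act v \<subset> act u"
    proof
      show "act v \<subseteq> act u" using vu by (force simp: act_def)
      have "e1 \<in> act u" using e1 c by (auto simp: act_def T_def)
      moreover have "e1 \<notin> act v" using e1 by (simp add: act_def v_def T_def)
      ultimately show "act v \<noteq> act u" by blast
    qed
    ultimately show False
      using least[of v] psubset_card_mono[of "act u" "act v"] finE by (simp add: act_def)
  qed
  have "u e0 \<le> total_mass mp" if e0: "e0 \<in> E" for e0
  proof (cases "u e0 > 0")
    case False
    then show ?thesis
      using msum_nonneg[OF uD(1), of "\<lambda>_. 1"] by (simp add: total_mass_eq_msum)
  next
    case True
    \<comment> \<open>All points reachable from the head of \<open>e0\<close> along active edges. If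
      the tail were among them, the path back, with edges counted by multiplicity in
      \<open>c\<close>, would close up with \<open>e0\<close> to a circulation.\<close>
    define S where "S = (act u)\<^sup>* `` {snd e0}"
    have "fst e0 \<notin> S"
    proof
      assume "fst e0 \<in> S"
      then have "(snd e0, fst e0) \<in> (act u)\<^sup>*" by (simp add: S_def)
      then have "\<exists>c. (\<forall>e\<in>E. 0 \<le> c e \<and> (c e > 0 \<longrightarrow> u e > 0)) \<and>
        (\<forall>f. (\<Sum>e\<in>E. c e * (f (snd e) - f (fst e))) = f (fst e0) - (f (snd e0) :: real))"
      proof (induction rule: rtrancl_induct)
        case base
        show ?case by (intro exI[of _ "\<lambda>_. 0"]) auto
      next
        case (step y z)
        then obtain c where c: "\<forall>e\<in>E. 0 \<le> c e \<and> (c e > 0 \<longrightarrow> u e > 0)"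
          "\<And>f. (\<Sum>e\<in>E. c e * (f (snd e) - f (fst e))) = f y - (f (snd e0) :: real)"
          by blast
        have yz: "(y, z) \<in> E" "u (y, z) > 0" using step by (auto simp: act_def)
        define c' where "c' e = c e + indicator {(y, z)} e" for e
        have "(\<Sum>e\<in>E. c' e * (f (snd e) - f (fst e))) = f z - (f (snd e0) :: real)" for f
        proof -
          have "(\<Sum>e\<in>E. indicator {(y, z)} e * (f (snd e) - f (fst e))) = f z - (f y :: real)"
            using finE yz by (subst sum.remove[of _ "(y, z)"]) (auto intro!: sum.neutral)
          then show ?thesis using c(2)[of f] by (simp add: c'_def distrib_right sum.distrib)
        qed
        moreover have "\<forall>e\<in>E. 0 \<le> c' e \<and> (c' e > 0 \<longrightarrow> u e > 0)"
          using c(1) yz by (auto simp: c'_def indicator_def)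
        ultimately show ?case by blast
      qed
      then obtain c where c: "\<And>e. e \<in> E \<Longrightarrow> 0 \<le> c e" "\<And>e. e \<in> E \<Longrightarrow> c e > 0 \<Longrightarrow> u e > 0"
        "\<And>f. (\<Sum>e\<in>E. c e * (f (snd e) - f (fst e))) = f (fst e0) - (f (snd e0) :: real)"
        by blast
      define c' where "c' e = c e + indicator {e0} e" for e
      show False
      proof (rule no_cycle[of c'])
        show "0 \<le> c' e" if "e \<in> E" for e using c(1)[OF that] by (simp add: c'_def)
        show "u e > 0" if "e \<in> E" "c' e > 0" for e
          using c(2)[of e] that True by (cases "e = e0") (auto simp: c'_def)
        show "\<exists>e\<in>E. c' e > 0"
          using e0 c(1)[OF e0] by (intro bexI[of _ e0]) (auto simp: c'_def)
        show "(\<Sum>e\<in>E. c' e * (f (snd e) - f (fst e))) = 0" for f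
        proof -
          have "(\<Sum>e\<in>E. indicator {e0} e * (f (snd e) - f (fst e))) = f (snd e0) - f (fst e0)"
            using finE e0 by (subst sum.remove[of _ e0]) (auto intro!: sum.neutral)
          then show ?thesis using c(3)[of f] by (simp add: c'_def distrib_right sum.distrib)
        qed
      qed
    qed
    moreover have "snd e0 \<in> S" by (simp add: S_def)
    ultimately have "u e0 = u e0 * (indicator S (snd e0) - indicator S (fst e0))" by simp
    \<comment> \<open>No active edge leaves \<open>S\<close>, so every term of the net flow into
      \<open>S\<close> is nonnegative, and the term of \<open>e0\<close> alone is a lower
      bound.\<close>
    also have "\<dots> \<le> (\<Sum>e\<in>E. u e * (indicator S (snd e) - indicator S (fst e)))"
    proof (rule member_le_sum[OF e0 _ finE])
      fix e assume e: "e \<in> E - {e0}"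
      have "snd e \<in> S" if "fst e \<in> S" "u e > 0"
      proof -
        have "(fst e, snd e) \<in> act u" using e that by (simp add: act_def)
        then show ?thesis using that by (auto simp: S_def intro: rtrancl_into_rtrancl)
      qed
      then show "0 \<le> u e * (indicator S (snd e) - indicator S (fst e))"
        using uD(5)[of e] e by (cases "u e > 0") (auto simp: indicator_def)
    qed
    also have "\<dots> = msum mm (indicator S) - msum mp (indicator S)"
      using mass_flux_divergence[OF uflux, of "indicator S"] by simp
    also have "\<dots> \<le> msum mm (indicator S)"
      using msum_nonneg[OF uD(1), of "indicator S"] by simp
    also have "\<dots> \<le> msum mm (\<lambda>_. 1)"
      by (intro msum_mono uD) (simp add: indicator_def)
    also have "\<dots> = total_mass mp"
      using uflux by (simp add: mass_flux_def total_mass_eq_msum)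
    finally show ?thesis .
  qed
  then show ?thesis using that uflux uw by blast
qed

section \<open>Push-forward and collapse of masses and graphs\<close>

definition push_mass :: "('a \<Rightarrow> 'b) \<Rightarrow> ('a \<Rightarrow> real) \<Rightarrow> 'b \<Rightarrow> real" where
  "push_mass q m y = (\<Sum>x\<in>{x\<in>{x. m x \<noteq> 0}. q x = y}. m x)"

lemma push_mass_support: "{y. push_mass q m y \<noteq> 0} \<subseteq> q ` {x. m x \<noteq> 0}"
proof
  fix y assume y: "y \<in> {y. push_mass q m y \<noteq> 0}"
  show "y \<in> q ` {x. m x \<noteq> 0}"
  proof (rule ccontr)
    assume "y \<notin> q ` {x. m x \<noteq> 0}"
    then have "{x\<in>{x. m x \<noteq> 0}. q x = y} = {}" by auto
    then have "push_mass q m y = 0" by (simp only: push_mass_def sum.empty)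
    then show False using y by simp
  qed
qed

lemma discrete_mass_push:
  assumes "discrete_mass m" shows "discrete_mass (push_mass q m)"
  unfolding discrete_mass_def
proof
  show "\<forall>y. 0 \<le> push_mass q m y"
    using assms by (auto simp: discrete_mass_def push_mass_def intro!: sum_nonneg)
  show "finite {y. push_mass q m y \<noteq> 0}"
    using assms by (intro finite_subset[OF push_mass_support]) (simp add: discrete_mass_def)
qed

lemma msum_push:
  assumes "discrete_mass m" shows "msum (push_mass q m) f = msum m (\<lambda>x. f (q x))"
proof -
  let ?S = "{x. m x \<noteq> 0}"
  have fin: "finite ?S" using assms by (simp add: discrete_mass_def)
  have "msum (push_mass q m) f = (\<Sum>y\<in>q ` ?S. push_mass q m y * f y)"
    by (rule msum_superset[OF finite_imageI[OF fin] push_mass_support])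
  also have "\<dots> = (\<Sum>y\<in>q ` ?S. \<Sum>x\<in>{x\<in>?S. q x = y}. m x * f (q x))"
    unfolding push_mass_def by (intro sum.cong refl) (auto simp: sum_distrib_right)
  also have "\<dots> = msum m (\<lambda>x. f (q x))"
    unfolding msum_def using fin by (intro sum.group) auto
  finally show ?thesis .
qed

text \<open>Edges with the same image are merged and their weights added, which by subadditivity
  costs no more than keeping them apart. Edges whose endpoints coincide after the map are dropped,
  as a flux requires; they contribute neither divergence nor length. The remaining lengths do not
  grow because \<open>q\<close> is 1-Lipschitz.\<close>

lemma mass_flux_push:
  fixes q :: "'a::euclidean_space \<Rightarrow> 'a"
  assumes flux: "mass_flux mp mm V E w" and \<tau>: "transportation_cost \<tau>"
    and lip: "\<And>x y. dist (q x) (q y) \<le> dist x y"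
  obtains V' E' w' where "mass_flux (push_mass q mp) (push_mass q mm) V' E' w'"
    "graph_cost \<tau> E' w' \<le> graph_cost \<tau> E w"
proof -
  note D = mass_fluxD[OF flux] and \<tau>D = transportation_costD[OF \<tau>]
  define Q where "Q = map_prod q q"
  define E' where "E' = {e \<in> Q ` E. fst e \<noteq> snd e}"
  define w' where "w' e' = (\<Sum>e\<in>{e\<in>E. Q e = e'}. w e)" for e'
  have w'0: "0 \<le> w' e'" for e' unfolding w'_def using D by (intro sum_nonneg) auto
  have sum_E': "(\<Sum>e'\<in>E'. h e') = (\<Sum>e'\<in>Q ` E. h e')"
    if "\<And>e. fst e = snd e \<Longrightarrow> h e = 0" for h :: "'a \<times> 'a \<Rightarrow> real"
    unfolding E'_def using D that by (intro sum.mono_neutral_left) auto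
  have "mass_flux (push_mass q mp) (push_mass q mm) (q ` V) E' w'"
  proof (rule mass_fluxI)
    fix f :: "'a \<Rightarrow> real"
    have "(\<Sum>e'\<in>E'. w' e' * (f (snd e') - f (fst e'))) = (\<Sum>e'\<in>Q ` E. w' e' * (f (snd e') - f (fst e')))"
      by (rule sum_E') simp
    also have "\<dots> = (\<Sum>e'\<in>Q ` E. \<Sum>e\<in>{e\<in>E. Q e = e'}. w e * (f (snd (Q e)) - f (fst (Q e))))"
      unfolding w'_def by (intro sum.cong refl) (auto simp: sum_distrib_right)
    also have "\<dots> = (\<Sum>e\<in>E. w e * (f (snd (Q e)) - f (fst (Q e))))"
      using D by (intro sum.group) auto
    finally show "msum (push_mass q mm) f = msum (push_mass q mp) f + (\<Sum>e'\<in>E'. w' e' * (f (snd e') - f (fst e')))"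
      using mass_flux_divergence[OF flux, of "\<lambda>x. f (q x)"] D by (simp add: msum_push Q_def)
  next
    show "fst e \<in> q ` V \<and> snd e \<in> q ` V \<and> fst e \<noteq> snd e" if "e \<in> E'" for e
      using that D(6) by (auto simp: E'_def Q_def)
  qed (use D w'0 in \<open>auto simp: discrete_mass_push E'_def\<close>)
  moreover have "graph_cost \<tau> E' w' \<le> graph_cost \<tau> E w"
  proof -
    have "graph_cost \<tau> E' w' = (\<Sum>e'\<in>Q ` E. \<tau> (w' e') * dist (fst e') (snd e'))"
      unfolding graph_cost_def by (rule sum_E') simp
    also have "\<dots> \<le> (\<Sum>e'\<in>Q ` E. \<Sum>e\<in>{e\<in>E. Q e = e'}. \<tau> (w e) * dist (fst (Q e)) (snd (Q e)))"
    proof (rule sum_mono)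
      fix e' assume "e' \<in> Q ` E"
      have "\<tau> (w' e') * dist (fst e') (snd e') \<le> (\<Sum>e\<in>{e\<in>E. Q e = e'}. \<tau> (w e)) * dist (fst e') (snd e')"
        unfolding w'_def using D by (intro mult_right_mono transportation_cost_sum \<tau>) auto
      also have "\<dots> = (\<Sum>e\<in>{e\<in>E. Q e = e'}. \<tau> (w e) * dist (fst (Q e)) (snd (Q e)))"
        by (simp add: sum_distrib_right)
      finally show "\<tau> (w' e') * dist (fst e') (snd e') \<le> \<dots>" .
    qed
    also have "\<dots> = (\<Sum>e\<in>E. \<tau> (w e) * dist (fst (Q e)) (snd (Q e)))"
      using D by (intro sum.group) auto
    also have "\<dots> \<le> graph_cost \<tau> E w"
      unfolding graph_cost_def Q_def using D \<tau>D(2) lip by (intro sum_mono mult_left_mono) auto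
    finally show ?thesis .
  qed
  ultimately show ?thesis using that by blast
qed

lemma msum_fun_upd:
  assumes "discrete_mass m" shows "msum (m(p := a)) f = msum m f + (a - m p) * f p"
proof -
  let ?S = "insert p {x. m x \<noteq> 0}"
  have fin: "finite ?S" using assms by (simp add: discrete_mass_def)
  have "msum (m(p := a)) f = (\<Sum>x\<in>?S. (m(p := a)) x * f x)"
    using fin by (intro msum_superset) auto
  also have "\<dots> = (\<Sum>x\<in>?S. m x * f x + (if x = p then (a - m p) * f p else 0))"
    by (intro sum.cong) (auto simp: algebra_simps)
  also have "\<dots> = msum m f + (a - m p) * f p"
    using fin by (subst sum.distrib) (simp add: msum_superset[OF fin, of m f, OF subset_insertI])
  finally show ?thesis .
qed

lemma discrete_mass_fun_upd:
  assumes "discrete_mass m" "0 \<le> a" shows "discrete_mass (m(p := a))"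
proof -
  have "{x. (m(p := a)) x \<noteq> 0} \<subseteq> insert p {x. m x \<noteq> 0}" by auto
  then have "finite {x. (m(p := a)) x \<noteq> 0}"
    by (rule finite_subset) (use assms in \<open>simp add: discrete_mass_def\<close>)
  then show ?thesis using assms by (simp add: discrete_mass_def)
qed

text \<open>Collapsing everything outside of a set to one point keeps only the net mass transported
  out of the set: the mass common to source and sink at that point can be cancelled.\<close>

lemma mass_flux_collapse:
  fixes q :: "'a::euclidean_space \<Rightarrow> 'a"
  assumes flux: "mass_flux mp mm V E w" and \<tau>: "transportation_cost \<tau>"
    and lip: "\<And>x y. dist (q x) (q y) \<le> dist x y"
    and out: "\<And>x. x \<notin> S \<Longrightarrow> q x = p"
  defines "B \<equiv> msum mp (indicator S) + msum mm (indicator S)"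
  obtains mp' mm' V' E' w' ap am where "mass_flux mp' mm' V' E' w'"
    "graph_cost \<tau> E' w' \<le> graph_cost \<tau> E w"
    "\<And>e. e \<in> E' \<Longrightarrow> w' e \<le> 2 * B"
    "0 \<le> ap" "ap \<le> B" "0 \<le> am" "am \<le> B"
    "\<And>f. msum mp' f = msum mp (\<lambda>x. indicator S x * f (q x)) + ap * f p"
    "\<And>f. msum mm' f = msum mm (\<lambda>x. indicator S x * f (q x)) + am * f p"
proof -
  note D = mass_fluxD[OF flux]
  obtain V' E' u where push: "mass_flux (push_mass q mp) (push_mass q mm) V' E' u"
    and cost: "graph_cost \<tau> E' u \<le> graph_cost \<tau> E w"
    using mass_flux_push[OF flux \<tau> lip] by blast
  note D' = mass_fluxD[OF push]
  define bp where "bp = msum mp (indicator (-S))"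
  define bm where "bm = msum mm (indicator (-S))"
  \<comment> \<open>The mass that sources and sinks have in common outside of \<open>S\<close>;
    after the push-forward both copies sit at \<open>p\<close> and cancel.\<close>
  define c where "c = min bp bm"
  have b0: "0 \<le> bp" "0 \<le> bm" unfolding bp_def bm_def by (auto intro!: msum_nonneg D)
  \<comment> \<open>Points of \<open>S\<close> may also be mapped to \<open>p\<close>, so this is
    only an inequality. It suffices to keep the masses at \<open>p\<close> nonnegative after
    subtracting \<open>c\<close>.\<close>
  have le: "msum m (indicator (-S)) \<le> push_mass q m p" if "discrete_mass m" for m
  proof -
    have "msum m (indicator (-S)) \<le> msum m (\<lambda>x. indicator {p} (q x))"
      using that out by (intro msum_mono) (auto simp: indicator_def)
    also have "\<dots> = push_mass q m p"
      using msum_push[OF that, of q "indicator {p}"]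
        msum_indicator_singleton[OF discrete_mass_push[OF that], of q p] by simp
    finally show ?thesis .
  qed
  define mp' where "mp' = (push_mass q mp)(p := push_mass q mp p - c)"
  define mm' where "mm' = (push_mass q mm)(p := push_mass q mm p - c)"
  have split: "msum (push_mass q m) f = msum m (\<lambda>x. indicator S x * f (q x)) + msum m (indicator (-S)) * f p"
    if "discrete_mass m" for m f
  proof -
    have "msum (push_mass q m) f = msum m (\<lambda>x. indicator S x * f (q x) + f p * indicator (-S) x)"
      unfolding msum_push[OF that] by (intro arg_cong[where f = "msum m"] ext) (auto simp: indicator_def out)
    then show ?thesis by (simp add: msum_add msum_cmult)
  qed
  have mp': "msum mp' f = msum mp (\<lambda>x. indicator S x * f (q x)) + (bp - c) * f p" for f
    unfolding mp'_def using D D' by (simp add: msum_fun_upd split bp_def algebra_simps)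
  have mm': "msum mm' f = msum mm (\<lambda>x. indicator S x * f (q x)) + (bm - c) * f p" for f
    unfolding mm'_def using D D' by (simp add: msum_fun_upd split bm_def algebra_simps)
  have "mass_flux mp' mm' V' E' u"
  proof (rule mass_fluxI)
    show "discrete_mass mp'" "discrete_mass mm'"
      unfolding mp'_def mm'_def using le[OF D(1)] le[OF D(2)]
      by (auto intro!: discrete_mass_fun_upd D' simp: c_def bp_def bm_def)
    show "msum mm' f = msum mp' f + (\<Sum>e\<in>E'. u e * (f (snd e) - f (fst e)))" for f
      using mass_flux_divergence[OF push, of f] D'
      by (simp add: mp'_def mm'_def msum_fun_upd)
  qed (use D' in auto)
  \<comment> \<open>Cycles are removed after the cancellation, since only then is the total mass,
    which bounds the weights, under control.\<close>
  then obtain w' where w': "mass_flux mp' mm' V' E' w'" "\<And>e. e \<in> E' \<Longrightarrow> w' e \<le> u e"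
    "\<And>e. e \<in> E' \<Longrightarrow> w' e \<le> total_mass mp'"
    using mass_flux_reduce by blast
  have "graph_cost \<tau> E' w' \<le> graph_cost \<tau> E' u"
    using mass_fluxD(5)[OF w'(1)] w'(2) by (intro graph_cost_mono \<tau>) auto
  then have cost': "graph_cost \<tau> E' w' \<le> graph_cost \<tau> E w" using cost by (rule order_trans)
  \<comment> \<open>Conservation makes \<open>bp - bm\<close> the difference of the masses inside
    \<open>S\<close>. One of the two remainders is 0 and the other is the absolute value of that
    difference.\<close>
  have B: "bp - c \<le> B" "bm - c \<le> B"
  proof -
    have "(\<lambda>x. indicator S x + indicator (-S) x) = (\<lambda>x. 1 :: real)"
      by (auto simp: indicator_def)
    then have "msum m (indicator S) + msum m (indicator (-S)) = msum m (\<lambda>_. 1)" for m :: "'a \<Rightarrow> real"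
      by (metis msum_add)
    then have "msum mp (indicator S) + bp = msum mm (indicator S) + bm"
      using mass_flux_divergence[OF flux, of "\<lambda>_. 1"] by (simp add: bp_def bm_def)
    moreover have "0 \<le> msum mp (indicator S)" "0 \<le> msum mm (indicator S)"
      by (auto intro!: msum_nonneg D)
    ultimately show "bp - c \<le> B" "bm - c \<le> B" unfolding B_def c_def by auto
  qed
  have "w' e \<le> 2 * B" if "e \<in> E'" for e
  proof -
    have "0 \<le> msum mm (indicator S)" by (auto intro!: msum_nonneg D)
    then have "total_mass mp' \<le> 2 * B"
      using B unfolding total_mass_eq_msum mp' by (simp add: B_def)
    then show ?thesis using w'(3)[OF that] by simp
  qed
  note wB = this
  show ?thesis
  proof (rule that[of mp' mm' V' E' w' "bp - c" "bm - c"])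
    show "mass_flux mp' mm' V' E' w'" by (rule w'(1))
    show "graph_cost \<tau> E' w' \<le> graph_cost \<tau> E w" by (rule cost')
    show "w' e \<le> 2 * B" if "e \<in> E'" for e using that by (rule wB)
    show "0 \<le> bp - c" "0 \<le> bm - c" by (simp_all add: c_def)
    show "bp - c \<le> B" "bm - c \<le> B" by (rule B)+
    show "msum mp' f = msum mp (\<lambda>x. indicator S x * f (q x)) + (bp - c) * f p" for f by (rule mp')
    show "msum mm' f = msum mm (\<lambda>x. indicator S x * f (q x)) + (bm - c) * f p" for f by (rule mm')
  qed
qed

text \<open>The identity on the ball of radius $R$ around $p$, radially reflected on the sphere of that
  radius, and constantly $p$ outside of the ball of radius $2R$. (At $x = p$ the quotient is
  $2R/0 = 0$, which is harmless since the scaled vector vanishes.)\<close>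

definition fold_map :: "real \<Rightarrow> 'a::real_inner \<Rightarrow> 'a \<Rightarrow> 'a" where
  "fold_map R p x = p + (max 0 (min 1 (2 * R / norm (x - p) - 1))) *\<^sub>R (x - p)"

lemma fold_map_inside: "dist x p \<le> R \<Longrightarrow> fold_map R p x = x"
proof (cases "x = p")
  case False
  assume "dist x p \<le> R"
  moreover have "norm (x - p) > 0" using False by simp
  ultimately have "2 * R / norm (x - p) - 1 \<ge> 1" by (simp add: dist_norm field_simps)
  then show ?thesis by (simp add: fold_map_def)
qed (simp add: fold_map_def)

lemma fold_map_outside: "0 < R \<Longrightarrow> 2 * R \<le> dist x p \<Longrightarrow> fold_map R p x = p"
proof -
  assume "0 < R" "2 * R \<le> dist x p"
  then have "2 * R / norm (x - p) - 1 \<le> 0" by (auto simp: dist_norm divide_le_eq)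
  then show ?thesis by (simp add: fold_map_def)
qed

text \<open>The squared distance of two rescaled vectors is the squared difference of their lengths
  plus an angular term. The length after folding is a 1-Lipschitz function of the length before. The
  angular term is nonnegative by Cauchy-Schwarz and is multiplied by
  \<open>\<kappa> a * \<kappa> b \<le> 1\<close>.\<close>

lemma fold_map_nonexpansive:
  assumes "0 < R" shows "dist (fold_map R p x) (fold_map R p y) \<le> dist x y"
proof -
  define \<kappa> where "\<kappa> a = max 0 (min 1 (2 * R / norm a - 1))" for a :: 'a
  have sq: "(norm (c *\<^sub>R a - d *\<^sub>R b))\<^sup>2 = (c * norm a - d * norm b)\<^sup>2 + 2 * (c * d) * (norm a * norm b - a \<bullet> b)"
    for c d and a b :: 'a
    by (simp add: power2_norm_eq_inner inner_diff_left inner_diff_right inner_commute power2_diff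
        power_mult_distrib algebra_simps) (simp add: power2_eq_square algebra_simps)
  have \<kappa>: "0 \<le> \<kappa> a" "\<kappa> a \<le> 1" "\<kappa> a * norm a = max 0 (min (norm a) (2 * R - norm a))" for a
  proof -
    show "0 \<le> \<kappa> a" "\<kappa> a \<le> 1" by (auto simp: \<kappa>_def)
    show "\<kappa> a * norm a = max 0 (min (norm a) (2 * R - norm a))"
    proof (cases "a = 0")
      case False
      then have "norm a > 0" by simp
      then show ?thesis
        by (auto simp: \<kappa>_def max_def min_def field_simps)
    qed (use assms in simp)
  qed
  define a b where "a = x - p" and "b = y - p"
  have "norm (\<kappa> a *\<^sub>R a - \<kappa> b *\<^sub>R b) \<le> norm (a - b)"
  proof (rule power2_le_imp_le)
    have "\<bar>\<kappa> a * norm a - \<kappa> b * norm b\<bar> \<le> \<bar>norm a - norm b\<bar>"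
      unfolding \<kappa> by (auto simp: max_def min_def)
    then have "(\<kappa> a * norm a - \<kappa> b * norm b)\<^sup>2 \<le> (norm a - norm b)\<^sup>2"
      by (simp add: abs_le_square_iff)
    moreover have "\<kappa> a * \<kappa> b * (norm a * norm b - a \<bullet> b) \<le> 1 * (norm a * norm b - a \<bullet> b)"
      using \<kappa>(1,2) norm_cauchy_schwarz[of a b] by (intro mult_right_mono mult_le_one) auto
    ultimately show "(norm (\<kappa> a *\<^sub>R a - \<kappa> b *\<^sub>R b))\<^sup>2 \<le> (norm (a - b))\<^sup>2"
      using sq[of "\<kappa> a" a "\<kappa> b" b] sq[of 1 a 1 b] by simp
  qed simp
  then show ?thesis by (simp add: fold_map_def dist_norm \<kappa>_def a_def b_def)
qed

section \<open>Weak-* compactness of bounded sequences of measures\<close>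

definition unit_ramp :: "real \<Rightarrow> real" where
  "unit_ramp t = max 0 (min 1 t)"

lemma unit_ramp_nonneg [simp]: "0 \<le> unit_ramp t"
  and unit_ramp_le_1 [simp]: "unit_ramp t \<le> 1"
  and unit_ramp_eq_0: "t \<le> 0 \<Longrightarrow> unit_ramp t = 0"
  and unit_ramp_eq_1: "1 \<le> t \<Longrightarrow> unit_ramp t = 1"
  by (auto simp: unit_ramp_def)

lemma continuous_on_unit_ramp [continuous_intros]:
  "continuous_on A f \<Longrightarrow> continuous_on A (\<lambda>x. unit_ramp (f x))"
  unfolding unit_ramp_def by (intro continuous_intros)

text \<open>The building block of Schoenberg's space-filling curve: it is 2-periodic, vanishes on
  $[0,1/3]$ and equals 1 on $[2/3,1]$, so it reads off ternary digits of points of the Cantor set.\<close>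

definition schoenberg_wave :: "real \<Rightarrow> real" where
  "schoenberg_wave t = unit_ramp (1/2 - cos (pi * t))"

lemma schoenberg_wave_bounds: "0 \<le> schoenberg_wave t" "schoenberg_wave t \<le> 1"
  by (simp_all add: schoenberg_wave_def)

lemma schoenberg_wave_periodic: "schoenberg_wave (2 * of_int m + t) = schoenberg_wave t"
proof -
  have "cos (pi * (2 * of_int m + t)) = cos (pi * t + 2 * pi * of_int m)"
    by (simp add: algebra_simps)
  also have "\<dots> = cos (pi * t)"
    by (simp add: cos_add cos_int_2pin sin_int_2pin del: mult.assoc)
  finally show ?thesis by (simp add: schoenberg_wave_def)
qed

text \<open>The shift 1/2 in the wave is \<open>cos (pi / 3)\<close>, and it is also
  \<open>- cos (2 * pi / 3)\<close>. As cosine decreases on [0, pi], the argument of the ramp is at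
  most 0 on the first third of the unit interval and at least 1 on the last.\<close>

lemma schoenberg_wave_eq_0:
  assumes "0 \<le> t" "t \<le> 1/3" shows "schoenberg_wave t = 0"
proof -
  have "pi * t \<le> pi * (1/3)" using assms by (intro mult_left_mono) auto
  then have "cos (pi / 3) \<le> cos (pi * t)"
    using assms by (intro cos_monotone_0_pi_le) auto
  then show ?thesis by (simp add: schoenberg_wave_def cos_60 unit_ramp_eq_0)
qed

lemma schoenberg_wave_eq_1:
  assumes "2/3 \<le> t" "t \<le> 1" shows "schoenberg_wave t = 1"
proof -
  have "pi * (2/3) \<le> pi * t" using assms by (intro mult_left_mono) auto
  moreover have "pi * t \<le> pi" using assms by simp
  ultimately have "cos (pi * t) \<le> cos (pi * (2/3))"
    using assms by (intro cos_monotone_0_pi_le) auto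
  also have "\<dots> = - (1/2)" using cos_120 by (simp add: mult.commute)
  finally show ?thesis by (simp add: schoenberg_wave_def unit_ramp_eq_1)
qed

lemma continuous_on_schoenberg_wave [continuous_intros]:
  fixes f :: "'a::t2_space \<Rightarrow> real"
  shows "continuous_on A f \<Longrightarrow> continuous_on A (\<lambda>x. schoenberg_wave (f x))"
  unfolding schoenberg_wave_def by (intro continuous_intros)

text \<open>For digits \<open>a j\<close> in {0, 1}, the point of the Cantor set with ternary digits
  \<open>2 * a j\<close>.\<close>

definition cantor_point :: "(nat \<Rightarrow> nat) \<Rightarrow> real" where
  "cantor_point a = (\<Sum>j. 2 * real (a j) / 3 ^ Suc j)"

lemma cantor_summable:
  assumes "\<And>j. a j \<le> (1::nat)"
  shows "summable (\<lambda>j. 2 * real (a j) / 3 ^ Suc j)"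
proof (rule summable_comparison_test')
  show "summable (\<lambda>j. 2/3 * (1/3::real) ^ j)"
    by (intro summable_mult summable_geometric) auto
  show "norm (2 * real (a j) / 3 ^ Suc j) \<le> 2/3 * (1/3) ^ j" if "j \<ge> 0" for j
    using assms[of j] by (simp add: field_simps)
qed

lemma cantor_point_bounds:
  assumes "\<And>j. a j \<le> (1::nat)"
  shows "0 \<le> cantor_point a" "cantor_point a \<le> 1"
proof -
  show "0 \<le> cantor_point a"
    unfolding cantor_point_def by (intro suminf_nonneg cantor_summable assms) auto
  have "cantor_point a \<le> (\<Sum>j. 2/3 * (1/3::real) ^ j)"
    unfolding cantor_point_def
  proof (intro suminf_le cantor_summable assms)
    show "summable (\<lambda>j. 2/3 * (1/3::real) ^ j)"
      by (intro summable_mult summable_geometric) auto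
    show "2 * real (a j) / 3 ^ Suc j \<le> 2/3 * (1/3) ^ j" for j
      using assms[of j] by (simp add: field_simps)
  qed
  also have "\<dots> = 1"
    by (subst suminf_mult) (auto simp: suminf_geometric)
  finally show "cantor_point a \<le> 1" .
qed

lemma cantor_point_shift:
  assumes "\<And>j. a j \<le> (1::nat)"
  shows "3 * cantor_point a = 2 * real (a 0) + cantor_point (\<lambda>j. a (Suc j))"
proof -
  have "3 * cantor_point a = (\<Sum>j. 3 * (2 * real (a j) / 3 ^ Suc j))"
    unfolding cantor_point_def by (intro suminf_mult[symmetric] cantor_summable assms)
  also have "\<dots> = (\<Sum>j. 2 * real (a j) / 3 ^ j)"
    by (simp add: field_simps)
  also have "\<dots> = (\<Sum>j. 2 * real (a (Suc j)) / 3 ^ Suc j) + 2 * real (a 0)"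
  proof -
    have "summable (\<lambda>j. 2 * real (a j) / 3 ^ j)"
      using summable_mult[OF cantor_summable[of a, OF assms], of 3] by (simp add: field_simps)
    from suminf_split_head[OF this] show ?thesis by simp
  qed
  finally show ?thesis by (simp add: cantor_point_def)
qed

text \<open>Multiplication by \<open>3 ^ m\<close> shifts the ternary expansion. The leading digits,
  being 0 or 2, turn into an even integer, which a 2-periodic function ignores; the digit at
  position \<open>m\<close> then decides whether the remainder lies in [0, 1/3] or in
  [2/3, 1].\<close>

lemma schoenberg_wave_cantor_point:
  assumes "\<And>j. a j \<le> (1::nat)"
  shows "schoenberg_wave (3 ^ m * cantor_point a) = a m"
proof -
  have "\<exists>i::int. 3 ^ m * cantor_point a = 2 * of_int i + cantor_point (\<lambda>j. a (j + m))"
  proof (induction m)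
    case 0
    show ?case by (intro exI[of _ 0]) auto
  next
    case (Suc m)
    then obtain i :: int where i: "3 ^ m * cantor_point a = 2 * of_int i + cantor_point (\<lambda>j. a (j + m))"
      by auto
    have "3 ^ Suc m * cantor_point a = 3 * (3 ^ m * cantor_point a)" by simp
    also have "\<dots> = 2 * of_int (3 * i) + 3 * cantor_point (\<lambda>j. a (j + m))"
      unfolding i by simp
    also have "3 * cantor_point (\<lambda>j. a (j + m)) = 2 * real (a m) + cantor_point (\<lambda>j. a (j + Suc m))"
      using cantor_point_shift[of "\<lambda>j. a (j + m)"] assms by simp
    finally show ?case
      by (intro exI[of _ "3 * i + int (a m)"]) simp
  qed
  then obtain i :: int where i: "3 ^ m * cantor_point a = 2 * of_int i + cantor_point (\<lambda>j. a (j + m))"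
    by auto
  define t where "t = cantor_point (\<lambda>j. a (j + m))"
  have t: "3 * t = 2 * real (a m) + cantor_point (\<lambda>j. a (Suc (j + m)))"
    unfolding t_def using cantor_point_shift[of "\<lambda>j. a (j + m)"] assms by simp
  have b: "0 \<le> cantor_point (\<lambda>j. a (Suc (j + m)))" "cantor_point (\<lambda>j. a (Suc (j + m))) \<le> 1"
    by (auto intro!: cantor_point_bounds assms)
  have "schoenberg_wave t = a m"
  proof (cases "a m = 0")
    case True
    then show ?thesis using t b by (auto intro!: schoenberg_wave_eq_0)
  next
    case False
    then have "a m = 1" using assms[of m] by linarith
    then show ?thesis using t b by (auto intro!: schoenberg_wave_eq_1)
  qed
  then show ?thesis
    unfolding i t_def[symmetric] by (simp only: schoenberg_wave_periodic)
qed

text \<open>The digits are the increments of dyadic floors, so the partial sums telescope to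
  \<open>\<lfloor>2 ^ N * y\<rfloor> / 2 ^ N\<close>, which is within \<open>1 / 2 ^ N\<close> of
  \<open>y\<close>.\<close>

lemma binary_expansion:
  fixes y :: real
  assumes "0 \<le> y" "y < 1"
  obtains a :: "nat \<Rightarrow> nat" where "\<And>k. a k \<le> 1" "(\<lambda>k. a k / 2 ^ Suc k) sums y"
proof -
  define f where "f N = \<lfloor>2 ^ N * y\<rfloor>" for N
  define a where "a k = nat (f (Suc k) - 2 * f k)" for k
  have f: "2 * f k \<le> f (Suc k)" "f (Suc k) \<le> 2 * f k + 1" for k
    unfolding f_def by (simp_all add: mult.assoc) linarith+
  have sum: "(\<Sum>k<N. a k / 2 ^ Suc k) = of_int (f N) / 2 ^ N" for N
  proof (induction N)
    case 0
    have "f 0 = 0" using assms by (simp add: f_def floor_eq_iff)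
    then show ?case by simp
  next
    case (Suc N)
    have "real (a N) = of_int (f (Suc N)) - 2 * of_int (f N)"
      using f[of N] by (simp add: a_def)
    then show ?case using Suc by (simp add: field_simps)
  qed
  have "(\<lambda>N. of_int (f N) / 2 ^ N) \<longlonglongrightarrow> y"
  proof (rule real_tendsto_sandwich)
    show "\<forall>\<^sub>F N in sequentially. y - (1/2) ^ N \<le> of_int (f N) / 2 ^ N"
    proof (intro always_eventually allI)
      fix N show "y - (1/2) ^ N \<le> of_int (f N) / 2 ^ N"
        using floor_correct[of "2 ^ N * y"] by (simp add: f_def power_one_over diff_le_eq add_divide_distrib[symmetric] pos_le_divide_eq mult.commute)
    qed
    show "\<forall>\<^sub>F N in sequentially. of_int (f N) / 2 ^ N \<le> y"
    proof (intro always_eventually allI)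
      fix N show "of_int (f N) / 2 ^ N \<le> y"
        using floor_correct[of "2 ^ N * y"] by (simp add: f_def field_simps)
    qed
    have "(\<lambda>N. y - (1/2) ^ N) \<longlonglongrightarrow> y - 0"
      by (intro tendsto_intros LIMSEQ_realpow_zero) auto
    then show "(\<lambda>N. y - (1/2) ^ N) \<longlonglongrightarrow> y" by simp
  qed auto
  then have "(\<lambda>k. a k / 2 ^ Suc k) sums y"
    unfolding sums_def sum .
  moreover have "a k \<le> 1" for k using f[of k] by (simp add: a_def)
  ultimately show ?thesis using that by blast
qed

text \<open>Each coordinate reads the ternary digits in one residue class of positions modulo the
  dimension and interprets them as binary digits. The digits of all coordinates of a target can
  therefore be interleaved in a single Cantor point. Continuity follows from uniform convergence. On
  the open ball every coordinate, rescaled from [-1, 1] to [0, 1], stays below 1, as the binary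
  expansion demands.\<close>

lemma space_filling_curve:
  obtains g :: "real \<Rightarrow> 'a::euclidean_space"
  where "continuous_on UNIV g" "ball 0 1 \<subseteq> g ` {0..1}"
proof -
  let ?n = "DIM('a)"
  obtain ix :: "'a \<Rightarrow> nat" where ix: "bij_betw ix Basis {0..<?n}"
    using ex_bij_betw_finite_nat[OF finite_Basis] by auto
  define c where "c b t = (\<Sum>k. schoenberg_wave (3 ^ (?n * k + ix b) * t) / 2 ^ Suc k)" for b and t :: real
  define g :: "real \<Rightarrow> 'a" where "g t = (\<Sum>b\<in>Basis. (2 * c b t - 1) *\<^sub>R b)" for t
  have geo: "summable (\<lambda>k. 1 / 2 ^ Suc k :: real)"
    using summable_mult[OF summable_geometric[of "1/2::real"], of "1/2"] by (simp add: power_divide)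
  have "continuous_on UNIV (c b)" for b
  proof (rule uniform_limit_theorem)
    show "uniform_limit UNIV (\<lambda>N t. \<Sum>k<N. schoenberg_wave (3 ^ (?n * k + ix b) * t) / 2 ^ Suc k)
       (c b) sequentially"
      unfolding c_def
    proof (rule Weierstrass_m_test[OF _ geo])
      show "norm (schoenberg_wave (3 ^ (?n * k + ix b) * t) / 2 ^ Suc k) \<le> 1 / 2 ^ Suc k" for k t
        using schoenberg_wave_bounds by (simp add: divide_simps)
    qed
    show "\<forall>\<^sub>F N in sequentially. continuous_on UNIV
        (\<lambda>t. \<Sum>k<N. schoenberg_wave (3 ^ (?n * k + ix b) * t) / 2 ^ Suc k)"
      by (intro always_eventually allI continuous_intros) auto
  qed auto
  then have "continuous_on UNIV g"
    unfolding g_def by (intro continuous_intros)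
  moreover have "ball 0 1 \<subseteq> g ` {0..1}"
  proof
    fix y :: 'a assume y: "y \<in> ball 0 1"
    define z where "z b = (y \<bullet> b + 1) / 2" for b
    have z: "0 \<le> z b \<and> z b < 1" if "b \<in> Basis" for b
      using Basis_le_norm[OF that, of y] y by (auto simp: z_def)
    have "\<forall>b\<in>Basis. \<exists>a::nat \<Rightarrow> nat. (\<forall>k. a k \<le> (1::nat)) \<and> (\<lambda>k. a k / 2 ^ Suc k) sums z b"
    proof
      fix b :: 'a assume "b \<in> Basis"
      then have "0 \<le> z b" "z b < 1" using z by auto
      then obtain a :: "nat \<Rightarrow> nat" where "\<And>k. a k \<le> 1" "(\<lambda>k. a k / 2 ^ Suc k) sums z b"
        using binary_expansion by blast
      then show "\<exists>a::nat \<Rightarrow> nat. (\<forall>k. a k \<le> (1::nat)) \<and> (\<lambda>k. a k / 2 ^ Suc k) sums z b"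
        by blast
    qed
    from bchoice[OF this] obtain A :: "'a \<Rightarrow> nat \<Rightarrow> nat"
      where A: "\<And>b k. b \<in> Basis \<Longrightarrow> A b k \<le> 1"
        "\<And>b. b \<in> Basis \<Longrightarrow> (\<lambda>k. A b k / 2 ^ Suc k) sums z b"
      by blast
    define a where "a m = A (inv_into Basis ix (m mod ?n)) (m div ?n)" for m
    have inv: "inv_into Basis ix (m mod ?n) \<in> Basis" for m
      using ix by (intro inv_into_into) (auto simp: bij_betw_def)
    have a1: "a m \<le> 1" for m unfolding a_def by (intro A inv)
    have aix: "a (?n * k + ix b) = A b k" if b: "b \<in> Basis" for b k
    proof -
      have "ix b < ?n" using ix b by (auto simp: bij_betw_def)
      moreover have "inv_into Basis ix (ix b) = b"
        using ix b by (auto simp: bij_betw_def)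
      ultimately show ?thesis by (simp add: a_def)
    qed
    have "c b (cantor_point a) = z b" if "b \<in> Basis" for b
      unfolding c_def schoenberg_wave_cantor_point[OF a1] aix[OF that]
      using A(2)[OF that] by (simp add: sums_iff)
    then have "g (cantor_point a) = (\<Sum>b\<in>Basis. (y \<bullet> b) *\<^sub>R b)"
      unfolding g_def by (intro sum.cong) (auto simp: z_def field_simps)
    then have "g (cantor_point a) = y" by (simp add: euclidean_representation)
    then show "y \<in> g ` {0..1}"
      using cantor_point_bounds[OF a1] by (intro image_eqI[of _ _ "cantor_point a"]) auto
  qed
  ultimately show ?thesis using that by blast
qed

section \<open>Functions vanishing at infinity and their extension from the open unit ball\<close>

lemma C0_continuous: "C0 \<phi> \<Longrightarrow> continuous_on UNIV \<phi>"
  by (simp add: C0_def)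

lemma C0_measurable: "C0 \<phi> \<Longrightarrow> \<phi> \<in> borel_measurable borel"
  by (simp add: C0_def borel_measurable_continuous_onI)

lemma C0_bounded:
  assumes "C0 \<phi>"
  obtains K where "K > 0" "\<And>x. \<bar>\<phi> x\<bar> \<le> K"
proof -
  obtain R where R: "\<And>x. R \<le> norm x \<Longrightarrow> \<bar>\<phi> x\<bar> \<le> 1"
    using assms unfolding C0_def by (meson zero_less_one)
  have "compact (\<phi> ` cball 0 R)"
    using assms by (intro compact_continuous_image) (auto simp: C0_def intro: continuous_on_subset)
  then obtain K where K: "\<And>x. x \<in> cball 0 R \<Longrightarrow> \<bar>\<phi> x\<bar> \<le> K"
    by (metis bounded_iff compact_imp_bounded imageI real_norm_def)
  show ?thesis
  proof (rule that[of "max 1 K"])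
    show "\<bar>\<phi> x\<bar> \<le> max 1 K" for x
      using R[of x] K[of x] by (cases "norm x \<le> R") (auto simp: max_def)
  qed auto
qed

lemma C0_I_bounded_support:
  assumes "continuous_on UNIV \<phi>" "\<And>x. R \<le> norm x \<Longrightarrow> \<phi> x = 0"
  shows "C0 \<phi>"
  using assms unfolding C0_def by (metis abs_zero less_imp_le)

lemma C0_integrable:
  assumes "C0 \<phi>" "finite_measure M" "sets M = sets borel"
  shows "integrable M \<phi>"
proof -
  interpret finite_measure M by fact
  obtain K where "\<And>x. \<bar>\<phi> x\<bar> \<le> K" using C0_bounded[OF assms(1)] by blast
  then show ?thesis
    using C0_measurable[OF assms(1)] by (intro integrable_const_bound[of _ K]) (auto simp: measurable_cong_sets[OF assms(3) refl])
qed

text \<open>The radial homeomorphism of the whole space onto the open unit ball compactifies the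
  space; functions vanishing at infinity extend by 0 across the unit sphere.\<close>

definition to_unit_ball :: "'a::real_normed_vector \<Rightarrow> 'a" where
  "to_unit_ball x = x /\<^sub>R (1 + norm x)"

definition of_unit_ball :: "'a::real_normed_vector \<Rightarrow> 'a" where
  "of_unit_ball y = y /\<^sub>R (1 - norm y)"

lemma norm_to_unit_ball: "norm (to_unit_ball x) = norm x / (1 + norm x)"
  by (simp add: to_unit_ball_def divide_inverse)

lemma norm_to_unit_ball_less: "norm (to_unit_ball x) < 1"
  by (simp add: norm_to_unit_ball add_pos_nonneg divide_less_eq)

lemma of_to_unit_ball: "of_unit_ball (to_unit_ball x) = x"
proof -
  have p: "1 + norm x > 0" by (simp add: add_pos_nonneg)
  then have "1 - norm (to_unit_ball x) = inverse (1 + norm x)"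
    by (simp add: norm_to_unit_ball field_simps)
  then show ?thesis
    unfolding of_unit_ball_def using p by (simp add: to_unit_ball_def)
qed

lemma continuous_on_to_unit_ball: "continuous_on UNIV to_unit_ball"
  unfolding to_unit_ball_def
  by (intro continuous_intros) (metis add_pos_nonneg norm_ge_zero zero_less_one less_numeral_extra(3))

lemma continuous_on_of_unit_ball: "continuous_on (ball 0 1) of_unit_ball"
  unfolding of_unit_ball_def by (intro continuous_intros) auto

lemma measurable_of_unit_ball [measurable]:
  "(of_unit_ball :: 'a::euclidean_space \<Rightarrow> 'a) \<in> borel_measurable borel"
  unfolding of_unit_ball_def by measurable

definition extend_C0 :: "('a::euclidean_space \<Rightarrow> real) \<Rightarrow> 'a \<Rightarrow> real" where
  "extend_C0 \<phi> y = (if norm y < 1 then \<phi> (of_unit_ball y) else 0)"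

lemma continuous_on_extend_C0:
  assumes "C0 \<phi>" shows "continuous_on UNIV (extend_C0 \<phi>)"
proof -
  have "continuous_on (ball 0 1) (\<lambda>y. \<phi> (of_unit_ball y))"
    by (intro continuous_on_compose2[OF C0_continuous[OF assms] continuous_on_of_unit_ball]) auto
  then have "continuous_on (ball 0 1) (extend_C0 \<phi>)"
    by (rule continuous_on_eq) (auto simp: extend_C0_def)
  then have inside: "isCont (extend_C0 \<phi>) y" if "norm y < 1" for y
    using that by (simp add: continuous_on_eq_continuous_at)
  have outside: "isCont (extend_C0 \<phi>) y" if y: "norm y \<ge> 1" for y
    unfolding continuous_at_eps_delta
  proof (intro allI impI)
    fix e :: real assume "e > 0"
    then obtain R where R: "\<And>x. R \<le> norm x \<Longrightarrow> \<bar>\<phi> x\<bar> \<le> e / 2"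
      using assms unfolding C0_def by (meson half_gt_zero)
    \<comment> \<open>Truncation at 0 keeps the radius \<open>1 / (1 + R')\<close> meaningful. A
      point of the open unit ball that is this close to \<open>y\<close> has norm above
      \<open>1 - 1 / (1 + R')\<close>, so its preimage has norm at least \<open>R'\<close>.\<close>
    define R' where "R' = max R 0"
    have small: "\<bar>extend_C0 \<phi> z\<bar> < e" if z: "dist z y < 1 / (1 + R')" for z
    proof (cases "norm z < 1")
      case True
      have "norm y \<le> norm z + dist z y"
        by (metis add.commute dist_commute dist_norm norm_triangle_sub)
      then have "norm z > 1 - 1 / (1 + R')" using y z by linarith
      then have "norm z \<ge> R' * (1 - norm z)"
        by (simp add: R'_def field_simps)
      then have "norm (of_unit_ball z) \<ge> R'"
        using True by (simp add: of_unit_ball_def field_simps)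
      then have "\<bar>\<phi> (of_unit_ball z)\<bar> \<le> e / 2" by (intro R) (simp add: R'_def)
      then show ?thesis using True \<open>e > 0\<close> by (simp add: extend_C0_def)
    qed (use \<open>e > 0\<close> in \<open>simp add: extend_C0_def\<close>)
    have "1 / (1 + R') > 0" by (simp add: R'_def)
    then show "\<exists>d>0. \<forall>z. dist z y < d \<longrightarrow> dist (extend_C0 \<phi> z) (extend_C0 \<phi> y) < e"
      using small y by (intro exI[of _ "1 / (1 + R')"]) (auto simp: extend_C0_def dist_real_def)
  qed
  show ?thesis
    unfolding continuous_on_eq_continuous_at[OF open_UNIV]
    using inside outside not_less by blast
qed

text \<open>A Borel section of the space-filling curve lifts the measures to [0, 1], where tightness
  is automatic and Helly's theorem applies. The limit is carried back along the curve. Mass may be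
  lost at infinity on the way, so the result is a finite measure and not a probability measure in
  general.\<close>

lemma prob_weak_star_compact:
  fixes P :: "nat \<Rightarrow> 'a::euclidean_space measure"
  assumes prob: "\<And>k. prob_space (P k)" and sets: "\<And>k. sets (P k) = sets borel"
  obtains r :: "nat \<Rightarrow> nat" and Q :: "'a measure" where "strict_mono r"
    "finite_measure Q" "sets Q = sets borel"
    "\<And>\<phi>. C0 \<phi> \<Longrightarrow> (\<lambda>k. \<integral>x. \<phi> x \<partial>P (r k)) \<longlonglongrightarrow> (\<integral>x. \<phi> x \<partial>Q)"
proof -
  obtain g :: "real \<Rightarrow> 'a" where cg: "continuous_on UNIV g" and surj: "ball 0 1 \<subseteq> g ` {0..1}"
    using space_filling_curve by blast
  have [measurable]: "g \<in> borel_measurable borel"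
    by (intro borel_measurable_continuous_onI cg)
  \<comment> \<open>The first time at which the curve visits the point. This section need not be
    continuous, but its sublevel sets are preimages of compact arcs of the curve, hence closed,
    which makes it Borel.\<close>
  define s where "s x = Inf ({0..1} \<inter> g -` {to_unit_ball x})" for x
  have bdd: "bdd_below ({0..1} \<inter> g -` {to_unit_ball x})" for x
    by (rule bdd_below_mono[of "{0..1}"]) auto
  have s: "s x \<in> {0..1} \<inter> g -` {to_unit_ball x}" for x
    unfolding s_def
  proof (rule closed_contains_Inf)
    show "{0..1} \<inter> g -` {to_unit_ball x} \<noteq> {}"
    proof -
      have "to_unit_ball x \<in> ball 0 1" using norm_to_unit_ball_less[of x] by simp
      then have "to_unit_ball x \<in> g ` {0..1}" by (rule subsetD[OF surj])
      then obtain t where "t \<in> {0..1}" "to_unit_ball x = g t" by (rule imageE)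
      then have "t \<in> {0..1} \<inter> g -` {to_unit_ball x}" by simp
      then show ?thesis by (metis empty_iff)
    qed
    show "closed ({0..1} \<inter> g -` {to_unit_ball x})"
      by (intro closed_Int closed_vimage cg) auto
  qed (rule bdd)
  have s_le: "s x \<le> t \<longleftrightarrow> to_unit_ball x \<in> g ` ({0..1} \<inter> {..t})" for x t
  proof
    assume "s x \<le> t"
    then show "to_unit_ball x \<in> g ` ({0..1} \<inter> {..t})"
      using s[of x] by (intro image_eqI[of _ _ "s x"]) auto
  next
    assume "to_unit_ball x \<in> g ` ({0..1} \<inter> {..t})"
    then obtain u where u: "u \<in> {0..1}" "u \<le> t" "g u = to_unit_ball x" by auto
    have "s x \<le> u"
      unfolding s_def using u by (intro cInf_lower bdd) auto
    then show "s x \<le> t" using u by simp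
  qed
  have s_meas: "s \<in> borel_measurable borel"
    unfolding borel_measurable_iff_le
  proof
    fix t :: real
    have "compact ({0..1} \<inter> {..t})" by (intro compact_Int_closed compact_Icc closed_atMost)
    then have "closed (g ` ({0..1} \<inter> {..t}))"
      by (intro compact_imp_closed compact_continuous_image continuous_on_subset[OF cg]) auto
    then have "closed (to_unit_ball -` (g ` ({0..1} \<inter> {..t})))"
      by (intro closed_vimage continuous_on_to_unit_ball)
    moreover have "{w \<in> space borel. s w \<le> t} = to_unit_ball -` (g ` ({0..1} \<inter> {..t}))"
      by (auto simp: s_le)
    ultimately show "{w \<in> space borel. s w \<le> t} \<in> sets borel"
      by simp
  qed
  have s_meas_P: "s \<in> borel_measurable (P k)" for k
    using s_meas by (simp add: measurable_cong_sets[OF sets refl])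
  define D where "D k = distr (P k) borel s" for k
  have rd: "real_distribution (D k)" for k
    unfolding D_def by (intro prob_space.real_distribution_distr prob s_meas_P)
  have "tight D"
    unfolding tight_def
  proof (intro conjI allI impI rd)
    fix e :: real assume e: "e > 0"
    have "measure (D k) {-1<..1} = 1" for k
    proof -
      have "measure (D k) {-1<..1} = measure (P k) (s -` {-1<..1} \<inter> space (P k))"
        unfolding D_def by (intro measure_distr s_meas_P) auto
      also have "s -` {-1<..1} \<inter> space (P k) = space (P k)"
      proof -
        have "s x \<in> {-1<..1}" for x using s[of x] by auto
        then show ?thesis by auto
      qed
      finally show ?thesis by (simp add: prob_space.prob_space prob)
    qed
    then show "\<exists>a b. a < b \<and> (\<forall>n. 1 - e < measure (D n) {a<..b})"
      using e by (intro exI[of _ "-1"] exI[of _ 1]) auto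
  qed
  from tight_imp_convergent_subsubsequence[OF this strict_mono_id]
  obtain r M where r: "strict_mono r" and M: "real_distribution M" and conv: "weak_conv_m (D \<circ> id \<circ> r) M"
    by blast
  interpret M: real_distribution M by fact
  \<comment> \<open>The limit may charge parameters where the curve lies on or outside the unit
    sphere. That is the mass lost at infinity; the extended test functions vanish there, so
    discarding it changes no integral.\<close>
  define w where "w t = (indicator {t. norm (g t) < 1} t :: real)" for t
  have [measurable]: "w \<in> borel_measurable borel" unfolding w_def by measurable
  define Q where "Q = distr (density M w) borel (\<lambda>t. of_unit_ball (g t))"
  have fin: "finite_measure Q"
  proof -
    have "finite_measure (density M w)"
    proof (rule finite_measureI)
      have "emeasure (density M w) (space (density M w)) = (\<integral>\<^sup>+t. ennreal (w t) \<partial>M)"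
        by (simp add: emeasure_density cong: nn_integral_cong)
      also have "\<dots> \<le> (\<integral>\<^sup>+t. 1 \<partial>M)"
        by (intro nn_integral_mono) (auto simp: w_def indicator_def)
      also have "\<dots> < \<infinity>" using M.emeasure_finite by (simp add: less_top[symmetric])
      finally show "emeasure (density M w) (space (density M w)) \<noteq> \<infinity>" by simp
    qed
    then show ?thesis unfolding Q_def
      by (rule finite_measure.finite_measure_distr) measurable
  qed
  have "(\<lambda>k. \<integral>x. \<phi> x \<partial>P (r k)) \<longlonglongrightarrow> (\<integral>x. \<phi> x \<partial>Q)" if \<phi>: "C0 \<phi>" for \<phi>
  proof -
    note [measurable] = C0_measurable[OF \<phi>]
    let ?f = "\<lambda>t. extend_C0 \<phi> (g t)"
    obtain K where K: "K > 0" "\<And>x. \<bar>\<phi> x\<bar> \<le> K" using C0_bounded[OF \<phi>] by blast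
    have cf: "continuous_on UNIV ?f"
      by (rule continuous_on_compose2[OF continuous_on_extend_C0[OF \<phi>] cg]) auto
    have "(\<lambda>k. integral\<^sup>L ((D \<circ> id \<circ> r) k) ?f) \<longlonglongrightarrow> integral\<^sup>L M ?f"
    proof (rule weak_conv_imp_integral_bdd_continuous_conv[OF _ M conv])
      show "isCont ?f x" for x using cf by (simp add: continuous_on_eq_continuous_at)
      show "norm (?f x) \<le> K" for x using K by (simp add: extend_C0_def)
    qed (use rd in auto)
    moreover have "integral\<^sup>L ((D \<circ> id \<circ> r) k) ?f = (\<integral>x. \<phi> x \<partial>P (r k))" for k
    proof -
      have "integral\<^sup>L ((D \<circ> id \<circ> r) k) ?f = (\<integral>x. ?f (s x) \<partial>P (r k))"
        unfolding D_def using cf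
        by (simp, intro integral_distr s_meas_P borel_measurable_continuous_onI)
      also have "(\<lambda>x. ?f (s x)) = \<phi>"
      proof
        fix x have "g (s x) = to_unit_ball x" using s[of x] by auto
        then show "?f (s x) = \<phi> x"
          by (simp add: extend_C0_def norm_to_unit_ball_less of_to_unit_ball)
      qed
      finally show ?thesis .
    qed
    moreover have "integral\<^sup>L M ?f = (\<integral>x. \<phi> x \<partial>Q)"
    proof -
      have "(\<integral>x. \<phi> x \<partial>Q) = (\<integral>t. \<phi> (of_unit_ball (g t)) \<partial>density M w)"
        unfolding Q_def by (intro integral_distr) measurable
      also have "\<dots> = (\<integral>t. w t *\<^sub>R \<phi> (of_unit_ball (g t)) \<partial>M)"
        by (intro integral_density) (auto simp: w_def)
      also have "\<dots> = integral\<^sup>L M ?f"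
        by (intro Bochner_Integration.integral_cong) (auto simp: w_def extend_C0_def)
      finally show ?thesis by simp
    qed
    ultimately show ?thesis by simp
  qed
  then show ?thesis using that[OF r fin] by (simp add: Q_def)
qed

text \<open>The measures are normalised to probability measures, and the limit is rescaled by the
  limit of the total masses along a further subsequence.\<close>

lemma weak_star_compact:
  fixes M :: "nat \<Rightarrow> 'a::euclidean_space measure"
  assumes fin: "\<And>k. finite_measure (M k)" and sets: "\<And>k. sets (M k) = sets borel"
    and bound: "\<And>k. measure (M k) UNIV \<le> C"
  obtains r :: "nat \<Rightarrow> nat" and Q :: "'a measure" where "strict_mono r"
    "finite_measure Q" "sets Q = sets borel"
    "\<And>\<phi>. C0 \<phi> \<Longrightarrow> (\<lambda>k. \<integral>x. \<phi> x \<partial>M (r k)) \<longlonglongrightarrow> (\<integral>x. \<phi> x \<partial>Q)"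
proof -
  define c where "c k = measure (M k) UNIV" for k
  \<comment> \<open>A zero measure cannot be normalised. The Dirac measure is an arbitrary stand-in,
    which the factor \<open>c k = 0\<close> suppresses later.\<close>
  define P where "P k = (if c k = 0 then return borel 0 else density (M k) (\<lambda>_. ennreal (1 / c k)))" for k
  have sp: "space (M k) = UNIV" for k using sets_eq_imp_space_eq[OF sets] by simp
  have c0: "c k \<ge> 0" for k by (simp add: c_def)
  have em: "emeasure (M k) UNIV = ennreal (c k)" for k
    unfolding c_def by (simp add: finite_measure.emeasure_eq_measure[OF fin])
  have "prob_space (P k)" for k
  proof (cases "c k = 0")
    case True
    then show ?thesis by (simp add: P_def prob_space_return)
  next
    case False
    have "emeasure (density (M k) (\<lambda>_. ennreal (1 / c k))) UNIV = ennreal (1 / c k) * ennreal (c k)"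
      using sp[of k] by (subst emeasure_density) (auto simp: em[symmetric] nn_integral_cmult sets)
    also have "\<dots> = 1" using False c0[of k] by (simp flip: ennreal_mult)
    finally show ?thesis using False by (intro prob_spaceI) (simp add: P_def sp)
  qed
  moreover have "sets (P k) = sets borel" for k by (simp add: P_def sets)
  ultimately obtain r Q where r: "strict_mono r" and Q: "finite_measure Q" "sets Q = sets borel"
    and conv: "\<And>\<phi>. C0 \<phi> \<Longrightarrow> (\<lambda>k. \<integral>x. \<phi> x \<partial>P (r k)) \<longlonglongrightarrow> (\<integral>x. \<phi> x \<partial>Q)"
    using prob_weak_star_compact by metis
  have "bounded (range (c \<circ> r))"
    using bound c0 unfolding bounded_iff by (auto simp: c_def)
  then obtain l r' where r': "strict_mono r'" and l: "(\<lambda>k. c (r (r' k))) \<longlonglongrightarrow> l"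
    using bounded_imp_convergent_subsequence[of "c \<circ> r"] by (auto simp: o_def)
  have l0: "l \<ge> 0" using l c0 by (intro LIMSEQ_le_const) auto
  have cP: "(\<integral>x. \<phi> x \<partial>M k) = c k * (\<integral>x. \<phi> x \<partial>P k)" if "C0 \<phi>" for \<phi> k
  proof (cases "c k = 0")
    case True
    then have "AE x in M k. False"
      using em[of k] by (intro AE_I[of _ _ UNIV]) (auto simp: sets)
    then have "(\<integral>x. \<phi> x \<partial>M k) = 0" by (intro integral_eq_zero_AE) auto
    then show ?thesis using True by simp
  next
    case False
    have "\<phi> \<in> borel_measurable (M k)"
      using C0_measurable[OF that] by (simp add: measurable_cong_sets[OF sets refl])
    then have "(\<integral>x. \<phi> x \<partial>P k) = (\<integral>x. (1 / c k) *\<^sub>R \<phi> x \<partial>M k)"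
      using False c0[of k] unfolding P_def by (simp add: integral_density)
    then show ?thesis using False by simp
  qed
  define Q' where "Q' = density Q (\<lambda>_. ennreal l)"
  show ?thesis
  proof (rule that[of "r \<circ> r'" Q'])
    show "strict_mono (r \<circ> r')" using r r' by (rule strict_mono_o)
    show "sets Q' = sets borel" by (simp add: Q'_def Q)
    show "finite_measure Q'"
    proof (rule finite_measureI)
      interpret Q: finite_measure Q by (rule Q)
      have "emeasure Q' (space Q') = ennreal l * emeasure Q (space Q)"
        unfolding Q'_def by (simp add: emeasure_density nn_integral_cmult cong: nn_integral_cong)
      then show "emeasure Q' (space Q') \<noteq> \<infinity>"
        by (simp add: Q.emeasure_eq_measure ennreal_mult_eq_top_iff)
    qed
    fix \<phi> :: "'a \<Rightarrow> real" assume \<phi>: "C0 \<phi>"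
    have "(\<lambda>k. c (r (r' k)) * (\<integral>x. \<phi> x \<partial>P (r (r' k)))) \<longlonglongrightarrow> l * (\<integral>x. \<phi> x \<partial>Q)"
      using LIMSEQ_subseq_LIMSEQ[OF conv[OF \<phi>] r'] by (intro tendsto_mult l) (simp add: o_def)
    moreover have "(\<integral>x. \<phi> x \<partial>Q') = l * (\<integral>x. \<phi> x \<partial>Q)"
      unfolding Q'_def using l0 C0_measurable[OF \<phi>]
      by (subst integral_density) (auto simp: measurable_cong_sets[OF Q(2) refl])
    ultimately show "(\<lambda>k. \<integral>x. \<phi> x \<partial>M ((r \<circ> r') k)) \<longlonglongrightarrow> (\<integral>x. \<phi> x \<partial>Q')"
      by (simp add: cP[OF \<phi>])
  qed
qed

section \<open>Integration against vector measures\<close>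

text \<open>The image under \<open>X\<close> of the measure with density \<open>g\<close> is
  absolutely continuous with respect to the image of \<open>M\<close>. The function \<open>p\<close>
  is its Radon-Nikodym derivative, i.e. the conditional expectation of \<open>g\<close> given
  \<open>X\<close> as a function of the value of \<open>X\<close>. It moves a density from the
  parameter space to the space where fluxes live.\<close>

lemma cond_density_nonneg:
  fixes g :: "'c \<Rightarrow> real" and X :: "'c \<Rightarrow> 'a::euclidean_space"
  assumes M: "finite_measure M" and X [measurable]: "X \<in> borel_measurable M"
    and g [measurable]: "g \<in> borel_measurable M" and g0: "\<And>\<omega>. 0 \<le> g \<omega>" and gK: "\<And>\<omega>. g \<omega> \<le> K"
  obtains p :: "'a \<Rightarrow> real" where "p \<in> borel_measurable borel" "integrable (distr M borel X) p"
    "\<And>\<phi>. \<phi> \<in> borel_measurable borel \<Longrightarrow> (\<integral>\<omega>. \<phi> (X \<omega>) * g \<omega> \<partial>M) = (\<integral>x. \<phi> x * p x \<partial>distr M borel X)"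
proof -
  interpret M: finite_measure M by fact
  define \<nu> where "\<nu> = distr M borel X"
  define P where "P = distr (density M g) borel X"
  have dens: "finite_measure (density M g)"
  proof (rule finite_measureI)
    have "emeasure (density M g) (space (density M g)) = (\<integral>\<^sup>+\<omega>. ennreal (g \<omega>) \<partial>M)"
      by (simp add: emeasure_density cong: nn_integral_cong)
    also have "\<dots> \<le> (\<integral>\<^sup>+\<omega>. ennreal K \<partial>M)"
      using gK by (intro nn_integral_mono ennreal_leI)
    also have "\<dots> < \<infinity>" by (simp add: M.emeasure_eq_measure ennreal_mult_less_top)
    finally show "emeasure (density M g) (space (density M g)) \<noteq> \<infinity>" by simp
  qed
  interpret P: finite_measure P
    unfolding P_def using dens by (rule finite_measure.finite_measure_distr) measurable
  interpret \<nu>: finite_measure \<nu>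
    unfolding \<nu>_def by (rule M.finite_measure_distr) measurable
  have sets: "sets P = sets \<nu>" by (simp add: P_def \<nu>_def)
  have ac: "absolutely_continuous \<nu> P"
    unfolding absolutely_continuous_def
  proof
    fix A assume "A \<in> null_sets \<nu>"
    then have A [measurable]: "A \<in> sets borel" and 0: "emeasure M (X -` A \<inter> space M) = 0"
      by (auto simp: null_sets_def \<nu>_def emeasure_distr)
    have "X -` A \<inter> space M \<in> null_sets M" using 0 by (auto simp: null_sets_def)
    then have "AE \<omega> in M. \<omega> \<notin> X -` A \<inter> space M" by (rule AE_not_in)
    then have "(\<integral>\<^sup>+\<omega>. ennreal (g \<omega>) * indicator (X -` A \<inter> space M) \<omega> \<partial>M) = (\<integral>\<^sup>+\<omega>. 0 \<partial>M)"
      by (intro nn_integral_cong_AE) (auto simp: indicator_def)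
    then have "emeasure P A = 0"
      by (simp add: P_def emeasure_distr emeasure_density)
    then show "A \<in> null_sets P" by (simp add: null_sets_def P_def)
  qed
  define p where "p x = enn2real (RN_deriv \<nu> P x)" for x
  have p [measurable]: "p \<in> borel_measurable borel"
  proof -
    have "RN_deriv \<nu> P \<in> borel_measurable \<nu>" by measurable
    then have "p \<in> borel_measurable \<nu>" unfolding p_def by measurable
    then show ?thesis by (simp add: \<nu>_def)
  qed
  have int: "integral\<^sup>L P \<phi> = (\<integral>x. \<phi> x * p x \<partial>\<nu>)" if "\<phi> \<in> borel_measurable borel" for \<phi>
    using \<nu>.RN_deriv_integral[OF P.sigma_finite_measure_axioms ac sets, of \<phi>] that
    by (simp add: p_def \<nu>_def mult.commute)
  have "integrable \<nu> p"
    using \<nu>.RN_deriv_integrable[OF P.sigma_finite_measure_axioms ac sets, of "\<lambda>_. 1"]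
    by (simp add: p_def[abs_def] \<nu>_def)
  moreover have "(\<integral>\<omega>. \<phi> (X \<omega>) * g \<omega> \<partial>M) = (\<integral>x. \<phi> x * p x \<partial>\<nu>)"
    if \<phi> [measurable]: "\<phi> \<in> borel_measurable borel" for \<phi>
  proof -
    have "integral\<^sup>L P \<phi> = (\<integral>\<omega>. \<phi> (X \<omega>) \<partial>density M g)"
      unfolding P_def by (rule integral_distr) measurable
    also have "\<dots> = (\<integral>\<omega>. \<phi> (X \<omega>) * g \<omega> \<partial>M)"
      using g0 by (subst integral_density) (auto simp: mult.commute)
    finally show ?thesis using int[OF \<phi>] by simp
  qed
  ultimately show ?thesis using that[OF p] by (simp add: \<nu>_def)
qed

lemma integrable_bounded_mult:
  fixes \<phi> d :: "'a \<Rightarrow> real"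
  assumes "integrable M d" "\<phi> \<in> borel_measurable M" "\<And>x. \<bar>\<phi> x\<bar> \<le> K"
  shows "integrable M (\<lambda>x. \<phi> x * d x)"
proof (rule Bochner_Integration.integrable_bound)
  show "integrable M (\<lambda>x. K * d x)" using assms(1) by simp
  show "(\<lambda>x. \<phi> x * d x) \<in> borel_measurable M" using assms by measurable
  have "K \<ge> 0" using assms(3)[of undefined] by linarith
  then show "AE x in M. norm (\<phi> x * d x) \<le> norm (K * d x)"
    using assms(3) by (intro AE_I2) (auto simp: abs_mult intro!: mult_right_mono)
qed

lemma cond_density:
  fixes g :: "'c \<Rightarrow> real" and X :: "'c \<Rightarrow> 'a::euclidean_space"
  assumes M: "finite_measure M" and X [measurable]: "X \<in> borel_measurable M"
    and g [measurable]: "g \<in> borel_measurable M" and gK: "\<And>\<omega>. \<bar>g \<omega>\<bar> \<le> K"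
  obtains d :: "'a \<Rightarrow> real" where "d \<in> borel_measurable borel" "integrable (distr M borel X) d"
    "\<And>\<phi> C. \<phi> \<in> borel_measurable borel \<Longrightarrow> (\<And>x. \<bar>\<phi> x\<bar> \<le> C) \<Longrightarrow>
      (\<integral>\<omega>. \<phi> (X \<omega>) * g \<omega> \<partial>M) = (\<integral>x. \<phi> x * d x \<partial>distr M borel X)"
proof -
  interpret M: finite_measure M by fact
  have K: "max 0 (g \<omega>) \<le> K" "max 0 (- g \<omega>) \<le> K" for \<omega>
    using gK[of \<omega>] by auto
  obtain p where p [measurable]: "p \<in> borel_measurable borel" and pi: "integrable (distr M borel X) p"
    and pp: "\<And>\<phi>. \<phi> \<in> borel_measurable borel \<Longrightarrow>
      (\<integral>\<omega>. \<phi> (X \<omega>) * max 0 (g \<omega>) \<partial>M) = (\<integral>x. \<phi> x * p x \<partial>distr M borel X)"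
    by (rule cond_density_nonneg[OF M X, of "\<lambda>\<omega>. max 0 (g \<omega>)" K]) (use K in auto)
  obtain n where n [measurable]: "n \<in> borel_measurable borel" and ni: "integrable (distr M borel X) n"
    and nn: "\<And>\<phi>. \<phi> \<in> borel_measurable borel \<Longrightarrow>
      (\<integral>\<omega>. \<phi> (X \<omega>) * max 0 (- g \<omega>) \<partial>M) = (\<integral>x. \<phi> x * n x \<partial>distr M borel X)"
    by (rule cond_density_nonneg[OF M X, of "\<lambda>\<omega>. max 0 (- g \<omega>)" K]) (use K in auto)
  show ?thesis
  proof (rule that[of "\<lambda>x. p x - n x"])
    fix \<phi> :: "'a \<Rightarrow> real" and C :: real
    assume \<phi> [measurable]: "\<phi> \<in> borel_measurable borel" and C: "\<And>x. \<bar>\<phi> x\<bar> \<le> C"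
    have i1: "integrable M (\<lambda>\<omega>. \<phi> (X \<omega>) * max 0 (g \<omega>))" "integrable M (\<lambda>\<omega>. \<phi> (X \<omega>) * max 0 (- g \<omega>))"
      by (intro integrable_bounded_mult[where K = C] C M.integrable_const_bound[where B = K],
          use K in auto)+
    have i2: "integrable (distr M borel X) (\<lambda>x. \<phi> x * p x)" "integrable (distr M borel X) (\<lambda>x. \<phi> x * n x)"
      by (intro integrable_bounded_mult[where K = C] C pi ni, simp)+
    have "(\<integral>\<omega>. \<phi> (X \<omega>) * g \<omega> \<partial>M) = (\<integral>\<omega>. \<phi> (X \<omega>) * max 0 (g \<omega>) - \<phi> (X \<omega>) * max 0 (- g \<omega>) \<partial>M)"
      by (intro Bochner_Integration.integral_cong) (auto simp: max_def)
    also have "\<dots> = (\<integral>x. \<phi> x * p x \<partial>distr M borel X) - (\<integral>x. \<phi> x * n x \<partial>distr M borel X)"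
      by (simp add: Bochner_Integration.integral_diff[OF i1] pp nn)
    also have "\<dots> = (\<integral>x. \<phi> x * p x - \<phi> x * n x \<partial>distr M borel X)"
      by (rule Bochner_Integration.integral_diff[OF i2, symmetric])
    finally show "(\<integral>\<omega>. \<phi> (X \<omega>) * g \<omega> \<partial>M) = (\<integral>x. \<phi> x * (p x - n x) \<partial>distr M borel X)"
      by (simp add: right_diff_distrib)
  qed (use pi ni in auto)
qed

text \<open>This is the Hahn decomposition of a measure with density: the supremum in the positive
  variation of \<open>A\<close> is attained at the part of \<open>A\<close> where \<open>d\<close>
  is positive.\<close>

lemma comp_pos_eq_density:
  fixes d :: "'a::euclidean_space \<Rightarrow> real"
  assumes \<nu>: "sets \<nu> = sets borel" and d: "integrable \<nu> d"
    and F: "\<And>B. B \<in> sets borel \<Longrightarrow> F B \<bullet> b = (\<integral>x. indicator B x * d x \<partial>\<nu>)"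
  shows "comp_pos F b = density \<nu> (\<lambda>x. ennreal (max 0 (d x)))"
proof -
  let ?D = "density \<nu> (\<lambda>x. ennreal (max 0 (d x)))"
  have [measurable]: "d \<in> borel_measurable borel"
    using borel_measurable_integrable[OF d] by (simp add: measurable_cong_sets[OF \<nu> refl])
  have sp: "space \<nu> = UNIV" using sets_eq_imp_space_eq[OF \<nu>] by simp
  have ind: "integrable \<nu> (\<lambda>x. indicator B x * h x)"
    if "B \<in> sets borel" "integrable \<nu> h" for B and h :: "'a \<Rightarrow> real"
    using that by (intro integrable_bounded_mult[where K = 1]) (auto simp: measurable_cong_sets[OF \<nu> refl] split: split_indicator)
  have imax: "integrable \<nu> (\<lambda>x. max 0 (d x))" using d by (intro integrable_max) auto
  have eq: "ennreal (Sup ((\<lambda>B. F B \<bullet> b) ` {B \<in> sets borel. B \<subseteq> A})) = emeasure ?D A"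
    if A [measurable]: "A \<in> sets borel" for A
  proof -
    let ?I = "\<integral>x. indicator A x * max 0 (d x) \<partial>\<nu>"
    have "Sup ((\<lambda>B. F B \<bullet> b) ` {B \<in> sets borel. B \<subseteq> A}) = ?I"
    proof (rule cSup_eq_maximum)
      have *: "A \<inter> {x. 0 < d x} \<in> sets borel" by measurable
      have "F (A \<inter> {x. 0 < d x}) \<bullet> b = ?I"
        unfolding F[OF *] by (intro Bochner_Integration.integral_cong) (auto simp: indicator_def)
      then show "?I \<in> (\<lambda>B. F B \<bullet> b) ` {B \<in> sets borel. B \<subseteq> A}"
        using * by (intro image_eqI[of _ _ "A \<inter> {x. 0 < d x}"]) auto
    next
      fix y assume "y \<in> (\<lambda>B. F B \<bullet> b) ` {B \<in> sets borel. B \<subseteq> A}"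
      then obtain B where B: "B \<in> sets borel" "B \<subseteq> A" "y = F B \<bullet> b" by auto
      show "y \<le> ?I"
        unfolding B(3) F[OF B(1)] using B
        by (intro integral_mono ind d imax A) (auto simp: indicator_def)
    qed
    moreover have "emeasure ?D A = ennreal ?I"
    proof -
      have "emeasure ?D A = (\<integral>\<^sup>+x. ennreal (indicator A x * max 0 (d x)) \<partial>\<nu>)"
        by (subst emeasure_density) (auto simp: \<nu> measurable_cong_sets[OF \<nu> refl] indicator_def intro!: nn_integral_cong)
      also have "\<dots> = ennreal ?I"
        by (intro nn_integral_eq_integral ind imax A) (auto simp: indicator_def)
      finally show ?thesis .
    qed
    ultimately show ?thesis by simp
  qed
  have "comp_pos F b = measure_of UNIV (sets borel) (emeasure ?D)"
    unfolding comp_pos_def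
  proof (rule measure_of_eq)
    fix A assume "A \<in> sigma_sets UNIV (sets (borel :: 'a measure))"
    then have "A \<in> sets borel" using sets.sigma_sets_eq[of "borel :: 'a measure"] by simp
    then show "ennreal (Sup ((\<lambda>B. F B \<bullet> b) ` {B \<in> sets borel. B \<subseteq> A})) = emeasure ?D A"
      by (rule eq)
  qed simp
  also have "\<dots> = ?D"
    using measure_of_of_measure[of ?D] by (simp add: \<nu> sp)
  finally show ?thesis .
qed

text \<open>\<open>vint\<close> is defined through the Jordan decomposition of each component, which
  cannot be read off from a parametrised vector measure whose contributions may overlap and cancel.
  Conditioning on \<open>X\<close> turns a component into a density with respect to
  \<open>distr M borel X\<close>. There both variations are explicit, and the integrals against them
  recombine.\<close>

lemma vint_eq_integral:
  fixes X G :: "'c \<Rightarrow> 'a::euclidean_space"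
  assumes M: "finite_measure M" and X [measurable]: "X \<in> borel_measurable M"
    and G [measurable]: "G \<in> borel_measurable M" and K: "\<And>\<omega>. norm (G \<omega>) \<le> K"
    and F: "\<And>B. B \<in> sets borel \<Longrightarrow> F B = (\<integral>\<omega>. indicator B (X \<omega>) *\<^sub>R G \<omega> \<partial>M)"
    and \<phi>: "C0 \<phi>"
  shows "vint F \<phi> = (\<integral>\<omega>. \<phi> (X \<omega>) *\<^sub>R G \<omega> \<partial>M)"
proof -
  interpret M: finite_measure M by fact
  note [measurable] = C0_measurable[OF \<phi>]
  have int: "integrable M (\<lambda>\<omega>. \<psi> (X \<omega>) *\<^sub>R G \<omega>)"
    if "\<psi> \<in> borel_measurable borel" "\<And>x. \<bar>\<psi> x\<bar> \<le> C" for \<psi> :: "'a \<Rightarrow> real" and C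
  proof (rule M.integrable_const_bound[where B = "C * K"])
    have "C \<ge> 0" using that(2)[of undefined] by linarith
    then show "AE \<omega> in M. norm (\<psi> (X \<omega>) *\<^sub>R G \<omega>) \<le> C * K"
      using that K by (intro AE_I2) (auto intro!: mult_mono)
  qed (use that in measurable)
  obtain C where C: "\<And>x. \<bar>\<phi> x\<bar> \<le> C" using C0_bounded[OF \<phi>] by blast
  have comp: "(\<integral>x. \<phi> x \<partial>comp_pos F b) - (\<integral>x. \<phi> x \<partial>comp_neg F b) = (\<integral>\<omega>. \<phi> (X \<omega>) *\<^sub>R G \<omega> \<partial>M) \<bullet> b"
    if b: "b \<in> Basis" for b
  proof -
    let ?\<nu> = "distr M borel X"
    have "\<bar>G \<omega> \<bullet> b\<bar> \<le> K" for \<omega> using Basis_le_norm[OF b, of "G \<omega>"] K[of \<omega>] by linarith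
    then obtain d where [measurable]: "d \<in> borel_measurable borel" and d: "integrable ?\<nu> d"
      and dd: "\<And>\<phi> C. \<phi> \<in> borel_measurable borel \<Longrightarrow> (\<And>x. \<bar>\<phi> x\<bar> \<le> C) \<Longrightarrow>
        (\<integral>\<omega>. \<phi> (X \<omega>) * (G \<omega> \<bullet> b) \<partial>M) = (\<integral>x. \<phi> x * d x \<partial>?\<nu>)"
      using cond_density[OF M X, of "\<lambda>\<omega>. G \<omega> \<bullet> b" K] by auto
    have inner: "(\<integral>\<omega>. \<psi> (X \<omega>) *\<^sub>R G \<omega> \<partial>M) \<bullet> b = (\<integral>x. \<psi> x * d x \<partial>?\<nu>)"
      if \<psi>: "\<psi> \<in> borel_measurable borel" "\<And>x. \<bar>\<psi> x\<bar> \<le> C" for \<psi> C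
    proof -
      have "(\<integral>\<omega>. \<psi> (X \<omega>) *\<^sub>R G \<omega> \<partial>M) \<bullet> b = (\<integral>\<omega>. (\<psi> (X \<omega>) *\<^sub>R G \<omega>) \<bullet> b \<partial>M)"
        by (rule integral_inner_left[symmetric]) (rule int[OF \<psi>])
      then show ?thesis using dd[OF \<psi>] by simp
    qed
    have Fd: "F B \<bullet> b = (\<integral>x. indicator B x * d x \<partial>?\<nu>)" if "B \<in> sets borel" for B
      unfolding F[OF that] using that by (intro inner[where C = 1]) (auto simp: indicator_def)
    have pos: "comp_pos F b = density ?\<nu> (\<lambda>x. ennreal (max 0 (d x)))"
      by (rule comp_pos_eq_density) (auto simp: d Fd)
    \<comment> \<open>The negative variation is the positive variation of \<open>- F\<close>, so one
      density formula serves both.\<close>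
    have "comp_neg F b = comp_pos (\<lambda>B. - F B) b"
      by (simp add: comp_neg_def comp_pos_def)
    also have "\<dots> = density ?\<nu> (\<lambda>x. ennreal (max 0 (- d x)))"
      by (rule comp_pos_eq_density) (auto simp: d Fd)
    finally have neg: "comp_neg F b = density ?\<nu> (\<lambda>x. ennreal (max 0 (- d x)))" .
    have i: "integrable ?\<nu> (\<lambda>x. \<phi> x * max 0 (d x))" "integrable ?\<nu> (\<lambda>x. \<phi> x * max 0 (- d x))"
      using d by (auto intro!: integrable_bounded_mult[where K = C] C integrable_max)
    have "(\<integral>x. \<phi> x \<partial>comp_pos F b) - (\<integral>x. \<phi> x \<partial>comp_neg F b) =
      (\<integral>x. \<phi> x * max 0 (d x) \<partial>?\<nu>) - (\<integral>x. \<phi> x * max 0 (- d x) \<partial>?\<nu>)"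
      unfolding pos neg by (simp add: integral_density mult.commute)
    also have "\<dots> = (\<integral>x. \<phi> x * max 0 (d x) - \<phi> x * max 0 (- d x) \<partial>?\<nu>)"
      by (rule Bochner_Integration.integral_diff[OF i, symmetric])
    also have "\<dots> = (\<integral>x. \<phi> x * d x \<partial>?\<nu>)"
      by (intro Bochner_Integration.integral_cong) (auto simp: max_def)
    also have "\<dots> = (\<integral>\<omega>. \<phi> (X \<omega>) *\<^sub>R G \<omega> \<partial>M) \<bullet> b"
      by (rule inner[symmetric]) (use C in auto)
    finally show ?thesis .
  qed
  show ?thesis
    unfolding vint_def by (subst euclidean_representation[symmetric]) (simp add: comp cong: sum.cong)
qed

lemma is_rca_integral:
  fixes X G :: "'c \<Rightarrow> 'a::euclidean_space"
  assumes X [measurable]: "X \<in> borel_measurable M" and G: "integrable M G"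
  shows "is_rca (\<lambda>B. \<integral>\<omega>. indicator B (X \<omega>) *\<^sub>R G \<omega> \<partial>M)"
  unfolding is_rca_def
proof (intro conjI allI impI)
  fix A :: "nat \<Rightarrow> 'a set"
  assume A: "range A \<subseteq> sets borel" and disj: "disjoint_family A"
  have [measurable]: "A i \<in> sets borel" for i using A by auto
  have [measurable]: "G \<in> borel_measurable M" "(\<Union>i. A i) \<in> sets borel" using G by auto
  have sums: "(\<lambda>i. indicator (A i) x *\<^sub>R y) sums (indicator (\<Union>i. A i) x *\<^sub>R y)" for x and y :: 'a
    using disj by (intro sums_scaleR_left indicator_sums) (auto simp: disjoint_family_on_def)
  have iA: "integrable M (\<lambda>\<omega>. indicator B (X \<omega>) *\<^sub>R G \<omega>)" if [measurable]: "B \<in> sets borel" for B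
    by (rule Bochner_Integration.integrable_bound[OF G]) (auto simp: indicator_def)
  have "(\<lambda>n. \<integral>\<omega>. (\<Sum>i<n. indicator (A i) (X \<omega>) *\<^sub>R G \<omega>) \<partial>M) \<longlonglongrightarrow> (\<integral>\<omega>. indicator (\<Union>i. A i) (X \<omega>) *\<^sub>R G \<omega> \<partial>M)"
  proof (rule integral_dominated_convergence[where w = "\<lambda>\<omega>. norm (G \<omega>)"])
    show "AE \<omega> in M. (\<lambda>n. \<Sum>i<n. indicator (A i) (X \<omega>) *\<^sub>R G \<omega>) \<longlonglongrightarrow> indicator (\<Union>i. A i) (X \<omega>) *\<^sub>R G \<omega>"
      using sums by (simp add: sums_def)
    show "AE \<omega> in M. norm (\<Sum>i<n. indicator (A i) (X \<omega>) *\<^sub>R G \<omega>) \<le> norm (G \<omega>)" for n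
    proof (rule AE_I2)
      fix \<omega>
      have "(\<Sum>i<n. indicator (A i) (X \<omega>) :: real) \<le> (\<Sum>i. indicator (A i) (X \<omega>))"
        using indicator_sums[of A "X \<omega>"] disj
        by (intro sum_le_suminf) (auto simp: sums_iff disjoint_family_on_def)
      also have "\<dots> = indicator (\<Union>i. A i) (X \<omega>)"
        using indicator_sums[of A "X \<omega>"] disj by (auto simp: sums_iff disjoint_family_on_def)
      also have "\<dots> \<le> 1" by (simp add: indicator_def)
      finally have "\<bar>\<Sum>i<n. indicator (A i) (X \<omega>) :: real\<bar> \<le> 1" by (simp add: sum_nonneg)
      then show "norm (\<Sum>i<n. indicator (A i) (X \<omega>) *\<^sub>R G \<omega>) \<le> norm (G \<omega>)"
        by (simp flip: scaleR_left.sum add: mult_left_le_one_le)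
    qed
    show "(\<lambda>\<omega>. indicator (\<Union>i. A i) (X \<omega>) *\<^sub>R G \<omega>) \<in> borel_measurable M" by measurable
    show "(\<lambda>\<omega>. \<Sum>i<n. indicator (A i) (X \<omega>) *\<^sub>R G \<omega>) \<in> borel_measurable M" for n by measurable
    show "integrable M (\<lambda>\<omega>. norm (G \<omega>))" using G by (rule integrable_norm)
  qed
  then show "(\<lambda>i. \<integral>\<omega>. indicator (A i) (X \<omega>) *\<^sub>R G \<omega> \<partial>M) sums (\<integral>\<omega>. indicator (\<Union>i. A i) (X \<omega>) *\<^sub>R G \<omega> \<partial>M)"
    unfolding sums_def by (subst (asm) Bochner_Integration.integral_sum) (auto intro: iA)
qed simp

section \<open>Graph fluxes as integrals over a parameter space\<close>

definition unit_segment :: "real measure" where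
  "unit_segment = restrict_space lborel {0..1}"

text \<open>The disjoint union of the parameter intervals of all edges. On it the flux of a whole
  graph is a single integral, even where edges overlap or cross in space.\<close>

definition edge_space :: "'e set \<Rightarrow> ('e \<times> real) measure" where
  "edge_space E = count_space E \<Otimes>\<^sub>M unit_segment"

lemma prob_space_unit_segment: "prob_space unit_segment"
  by (rule prob_spaceI) (simp add: unit_segment_def space_restrict_space emeasure_restrict_space)

lemma measurable_edge_space:
  assumes "finite E" "\<And>e. e \<in> E \<Longrightarrow> (\<lambda>t. f (e, t)) \<in> borel_measurable borel"
  shows "f \<in> borel_measurable (edge_space E)"
  unfolding edge_space_def unit_segment_def using assms
  by (intro measurable_pair_measure_countable1 measurable_restrict_space1) (auto simp: countable_finite)

lemma finite_measure_edge_space: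
  assumes "finite E" shows "finite_measure (edge_space E)"
proof -
  interpret prob_space unit_segment by (rule prob_space_unit_segment)
  show ?thesis
    unfolding edge_space_def
    by (intro finite_measure_pair_measure finite_measure_count_space assms finite_measure_axioms)
qed

lemma integral_edge_space:
  fixes f :: "'e \<times> real \<Rightarrow> 'b::{banach, second_countable_topology}"
  assumes E: "finite E" and f: "integrable (edge_space E) f"
  shows "integral\<^sup>L (edge_space E) f = (\<Sum>e\<in>E. \<integral>t. f (e, t) \<partial>unit_segment)"
proof -
  interpret U: prob_space unit_segment by (rule prob_space_unit_segment)
  interpret C: finite_measure "count_space E" using E by (rule finite_measure_count_space)
  interpret pair_sigma_finite "count_space E" unit_segment ..
  show ?thesis
    using integral_fst'[of f] f E
    by (simp add: edge_space_def lebesgue_integral_count_space_finite)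
qed

definition edge_point :: "('a::euclidean_space \<times> 'a) \<times> real \<Rightarrow> 'a" where
  "edge_point = (\<lambda>(e, t). fst e + t *\<^sub>R (snd e - fst e))"

lemma measurable_edge_point: "finite E \<Longrightarrow> edge_point \<in> borel_measurable (edge_space E)"
  by (rule measurable_edge_space) (auto simp: edge_point_def)

lemma measurable_edge_fun: "finite E \<Longrightarrow> (\<lambda>z. h (fst z)) \<in> borel_measurable (edge_space E)"
  by (rule measurable_edge_space) auto

lemma space_edge_space: "space (edge_space E) = E \<times> {0..1}"
  by (simp add: edge_space_def unit_segment_def space_pair_measure space_restrict_space)

lemma graph_flux_eq_integral:
  fixes E :: "('a::euclidean_space \<times> 'a) set"
  assumes E: "finite E" and A [measurable]: "A \<in> sets borel"
  shows "graph_flux E w A = (\<integral>z. indicator A (edge_point z) *\<^sub>R (w (fst z) *\<^sub>R (snd (fst z) - fst (fst z))) \<partial>edge_space E)"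
proof -
  interpret finite_measure "edge_space E" using E by (rule finite_measure_edge_space)
  interpret U: prob_space unit_segment by (rule prob_space_unit_segment)
  note [measurable] = measurable_edge_point[OF E]
  define G where "G e = w e *\<^sub>R (snd e - fst e)" for e :: "'a \<times> 'a"
  have [measurable]: "(\<lambda>z. G (fst z)) \<in> borel_measurable (edge_space E)"
    using E by (rule measurable_edge_fun)
  have "integrable (edge_space E) (\<lambda>z. indicator A (edge_point z) *\<^sub>R G (fst z))"
  proof (rule integrable_const_bound[where B = "\<Sum>e\<in>E. norm (G e)"])
    show "AE z in edge_space E. norm (indicator A (edge_point z) *\<^sub>R G (fst z)) \<le> (\<Sum>e\<in>E. norm (G e))"
    proof (rule AE_I2)
      fix z assume "z \<in> space (edge_space E)"
      then have "norm (G (fst z)) \<le> (\<Sum>e\<in>E. norm (G e))"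
        using E by (intro member_le_sum) (auto simp: space_edge_space)
      moreover have "norm (indicator A (edge_point z) *\<^sub>R G (fst z)) \<le> norm (G (fst z))"
        by (simp add: indicator_def)
      ultimately show "norm (indicator A (edge_point z) *\<^sub>R G (fst z)) \<le> (\<Sum>e\<in>E. norm (G e))"
        by linarith
    qed
  qed measurable
  then have "(\<integral>z. indicator A (edge_point z) *\<^sub>R G (fst z) \<partial>edge_space E) =
    (\<Sum>e\<in>E. \<integral>t. indicator A (edge_point (e, t)) *\<^sub>R G e \<partial>unit_segment)"
    by (subst integral_edge_space[OF E]) auto
  also have "\<dots> = graph_flux E w A"
    unfolding graph_flux_def
  proof (rule sum.cong[OF refl])
    fix e assume "e \<in> E"
    let ?T = "{t::real. 0 \<le> t \<and> t \<le> 1 \<and> fst e + t *\<^sub>R (snd e - fst e) \<in> A}"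
    have T: "?T \<in> sets borel" by measurable
    have "(\<integral>t. indicator A (edge_point (e, t)) *\<^sub>R G e \<partial>unit_segment) =
        (\<integral>t. indicator {0..1} t *\<^sub>R (indicator A (edge_point (e, t)) *\<^sub>R G e) \<partial>lborel)"
      unfolding unit_segment_def by (rule integral_restrict_space) simp
    also have "\<dots> = (\<integral>t. indicator ?T t *\<^sub>R G e \<partial>lborel)"
      by (intro Bochner_Integration.integral_cong) (auto simp: indicator_def edge_point_def)
    also have "\<dots> = measure lborel ?T *\<^sub>R G e"
    proof -
      have "emeasure lborel ?T \<le> emeasure lborel {0..1::real}"
        by (intro emeasure_mono) auto
      also have "\<dots> < \<infinity>" by simp
      finally show ?thesis using T by (subst integral_scaleR_left) auto
    qed
    finally show "(\<integral>t. indicator A (edge_point (e, t)) *\<^sub>R G e \<partial>unit_segment) =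
        (w e * measure lborel ?T) *\<^sub>R (snd e - fst e)"
      by (simp add: G_def mult.commute)
  qed
  finally show ?thesis by (simp add: G_def)
qed

lemma vint_graph_flux:
  fixes E :: "('a::euclidean_space \<times> 'a) set"
  assumes E: "finite E" and \<phi>: "C0 \<phi>"
  shows "vint (graph_flux E w) \<phi> =
    (\<integral>z. \<phi> (edge_point z) *\<^sub>R (w (fst z) *\<^sub>R (snd (fst z) - fst (fst z))) \<partial>edge_space E)"
proof -
  \<comment> \<open>Set to 0 off \<open>E\<close> because the integral formula for
    \<open>vint\<close> asks for a bound at every argument, not only on the underlying
    space.\<close>
  define G where "G e = (if e \<in> E then w e *\<^sub>R (snd e - fst e) else 0)" for e :: "'a \<times> 'a"
  have G: "G (fst z) = w (fst z) *\<^sub>R (snd (fst z) - fst (fst z))" if "z \<in> space (edge_space E)" for z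
    using that by (auto simp: G_def space_edge_space)
  have "vint (graph_flux E w) \<phi> = (\<integral>z. \<phi> (edge_point z) *\<^sub>R G (fst z) \<partial>edge_space E)"
  proof (rule vint_eq_integral)
    show "norm (G (fst z)) \<le> (\<Sum>e\<in>E. norm (G e))" for z
    proof (cases "fst z \<in> E")
      case True
      then show ?thesis using E by (intro member_le_sum) auto
    next
      case False
      then show ?thesis by (simp add: G_def[of "fst z"] sum_nonneg)
    qed
    show "graph_flux E w B = (\<integral>z. indicator B (edge_point z) *\<^sub>R G (fst z) \<partial>edge_space E)"
      if "B \<in> sets borel" for B
      unfolding graph_flux_eq_integral[OF E that]
      by (intro Bochner_Integration.integral_cong refl) (simp add: G)
  qed (use E \<phi> in \<open>auto intro: finite_measure_edge_space measurable_edge_point measurable_edge_fun\<close>)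
  also have "\<dots> = (\<integral>z. \<phi> (edge_point z) *\<^sub>R (w (fst z) *\<^sub>R (snd (fst z) - fst (fst z))) \<partial>edge_space E)"
    by (intro Bochner_Integration.integral_cong refl) (simp add: G)
  finally show ?thesis .
qed

section \<open>Compactness of fluxes\<close>

text \<open>The identity does not vanish at infinity and is no admissible test function in the
  direction variable. This truncation has bounded support and agrees with the identity on unit
  vectors, the only directions that edges have.\<close>

definition clip :: "'a::real_normed_vector \<Rightarrow> 'a" where
  "clip \<theta> = unit_ramp (2 - norm \<theta>) *\<^sub>R \<theta>"

lemma continuous_on_clip: "continuous_on UNIV clip"
  unfolding clip_def by (intro continuous_intros)

lemma clip_unit: "norm \<theta> \<le> 1 \<Longrightarrow> clip \<theta> = \<theta>"
  by (simp add: clip_def unit_ramp_eq_1)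

lemma clip_eq_0: "2 \<le> norm \<theta> \<Longrightarrow> clip \<theta> = 0"
  by (simp add: clip_def unit_ramp_eq_0)

lemma norm_clip: "norm (clip \<theta>) \<le> 2"
proof (cases "norm \<theta> \<le> 2")
  case True
  have "unit_ramp (2 - norm \<theta>) * norm \<theta> \<le> 1 * 2"
    using True by (intro mult_mono) auto
  then show ?thesis by (simp add: clip_def)
qed (simp add: clip_eq_0)

lemma C0_clip:
  fixes \<phi> :: "'a::euclidean_space \<Rightarrow> real" and b :: 'a
  assumes \<phi>: "C0 \<phi>" and b: "b \<in> Basis"
  shows "C0 (\<lambda>z. \<phi> (fst z) * (clip (snd z) \<bullet> b))"
  unfolding C0_def
proof (intro conjI allI impI)
  show "continuous_on UNIV (\<lambda>z. \<phi> (fst z) * (clip (snd z) \<bullet> b))"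
    by (intro continuous_intros continuous_on_compose2[OF C0_continuous[OF \<phi>]]
        continuous_on_compose2[OF continuous_on_clip]) auto
  fix e :: real assume "e > 0"
  then obtain R where R: "\<And>x. R \<le> norm x \<Longrightarrow> \<bar>\<phi> x\<bar> \<le> e / 2"
    using \<phi> unfolding C0_def by (meson half_gt_zero)
  \<comment> \<open>If a pair has norm at least \<open>R + 2\<close>, then either its second
    component has norm at least 2, where \<open>clip\<close> vanishes, or its first component has
    norm at least \<open>R\<close>, where \<open>\<phi>\<close> is small.\<close>
  have "\<bar>\<phi> (fst z) * (clip (snd z) \<bullet> b)\<bar> \<le> e" if "R + 2 \<le> norm z" for z :: "'a \<times> 'a"
  proof (cases "2 \<le> norm (snd z)")
    case True
    then show ?thesis using \<open>e > 0\<close> by (simp add: clip_eq_0)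
  next
    case False
    have "norm z \<le> norm (fst z) + norm (snd z)"
      by (metis norm_Pair_le prod.collapse)
    then have "\<bar>\<phi> (fst z)\<bar> \<le> e / 2" using that False by (intro R) linarith
    moreover have "\<bar>clip (snd z) \<bullet> b\<bar> \<le> 2"
      using Basis_le_norm[OF b, of "clip (snd z)"] norm_clip[of "snd z"] by linarith
    ultimately have "\<bar>\<phi> (fst z)\<bar> * \<bar>clip (snd z) \<bullet> b\<bar> \<le> e / 2 * 2"
      using \<open>e > 0\<close> by (intro mult_mono) auto
    then show ?thesis by (simp add: abs_mult)
  qed
  then show "\<exists>R. \<forall>z. R \<le> norm z \<longrightarrow> \<bar>\<phi> (fst z) * (clip (snd z) \<bullet> b)\<bar> \<le> e" by blast
qed

text \<open>A flux is encoded as a nonnegative measure on pairs of positions and unit directions; weak-*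
  compactness of such measures then yields a limiting vector measure.\<close>

definition edge_direction :: "'a::euclidean_space \<times> 'a \<Rightarrow> 'a" where
  "edge_direction e = (snd e - fst e) /\<^sub>R dist (fst e) (snd e)"

definition flux_lift :: "('a::euclidean_space \<times> 'a) set \<Rightarrow> ('a \<times> 'a \<Rightarrow> real) \<Rightarrow> ('a \<times> 'a) measure" where
  "flux_lift E w = distr (density (edge_space E) (\<lambda>z. ennreal (w (fst z) * dist (fst (fst z)) (snd (fst z)))))
     borel (\<lambda>z. (edge_point z, edge_direction (fst z)))"

lemma integral_flux_lift:
  fixes \<Phi> :: "'a::euclidean_space \<times> 'a \<Rightarrow> real"
  assumes E: "finite E" and w: "\<And>e. e \<in> E \<Longrightarrow> 0 \<le> w e" and [measurable]: "\<Phi> \<in> borel_measurable borel"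
  shows "integral\<^sup>L (flux_lift E w) \<Phi> = (\<integral>z. (w (fst z) * dist (fst (fst z)) (snd (fst z))) *
    \<Phi> (edge_point z, edge_direction (fst z)) \<partial>edge_space E)"
proof -
  note [measurable] = measurable_edge_point[OF E] measurable_edge_fun[OF E, of edge_direction]
    measurable_edge_fun[OF E, of "\<lambda>e. w e * dist (fst e) (snd e)"]
  have pair: "(\<lambda>z. (edge_point z, edge_direction (fst z))) \<in> borel_measurable (edge_space E)"
    by (intro borel_measurable_Pair) measurable
  have "integral\<^sup>L (flux_lift E w) \<Phi> = (\<integral>z. \<Phi> (edge_point z, edge_direction (fst z))
    \<partial>density (edge_space E) (\<lambda>z. ennreal (w (fst z) * dist (fst (fst z)) (snd (fst z)))))"
    unfolding flux_lift_def by (rule integral_distr) (simp_all add: pair)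
  also have "\<dots> = (\<integral>z. (w (fst z) * dist (fst (fst z)) (snd (fst z))) *\<^sub>R
    \<Phi> (edge_point z, edge_direction (fst z)) \<partial>edge_space E)"
  proof (rule integral_density)
    show "(\<lambda>z. \<Phi> (edge_point z, edge_direction (fst z))) \<in> borel_measurable (edge_space E)"
      by (rule measurable_compose[OF pair]) measurable
    show "AE z in edge_space E. 0 \<le> w (fst z) * dist (fst (fst z)) (snd (fst z))"
      using w by (intro AE_I2) (auto simp: space_edge_space)
  qed measurable
  finally show ?thesis by simp
qed

text \<open>Weight times length, summed over the edges, is the quantity that the cost controls
  through the linear lower bound for \<open>\<tau>\<close>, once the weights are bounded.\<close>

lemma flux_lift_mass:
  fixes E :: "('a::euclidean_space \<times> 'a) set"
  assumes E: "finite E" and w: "\<And>e. e \<in> E \<Longrightarrow> 0 \<le> w e"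
  shows "finite_measure (flux_lift E w)"
    "measure (flux_lift E w) UNIV = (\<Sum>e\<in>E. w e * dist (fst e) (snd e))"
proof -
  interpret finite_measure "edge_space E" using E by (rule finite_measure_edge_space)
  interpret U: prob_space unit_segment by (rule prob_space_unit_segment)
  let ?f = "\<lambda>z::('a \<times> 'a) \<times> real. w (fst z) * dist (fst (fst z)) (snd (fst z))"
  note [measurable] = measurable_edge_point[OF E] measurable_edge_fun[OF E, of edge_direction]
    measurable_edge_fun[OF E, of "\<lambda>e. w e * dist (fst e) (snd e)"]
  have int: "integrable (edge_space E) ?f"
  proof (rule integrable_const_bound[where B = "\<Sum>e\<in>E. w e * dist (fst e) (snd e)"])
    show "AE z in edge_space E. norm (?f z) \<le> (\<Sum>e\<in>E. w e * dist (fst e) (snd e))"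
    proof (rule AE_I2)
      fix z assume "z \<in> space (edge_space E)"
      then have z: "fst z \<in> E" by (auto simp: space_edge_space)
      have "?f z \<le> (\<Sum>e\<in>E. w e * dist (fst e) (snd e))"
        using E w z by (intro member_le_sum[where f = "\<lambda>e. w e * dist (fst e) (snd e)"]) auto
      then show "norm (?f z) \<le> (\<Sum>e\<in>E. w e * dist (fst e) (snd e))" using w[OF z] by simp
    qed
  qed measurable
  have "finite_measure (density (edge_space E) (\<lambda>z. ennreal (?f z)))"
  proof (rule finite_measureI)
    have "emeasure (density (edge_space E) (\<lambda>z. ennreal (?f z))) (space (edge_space E)) =
      (\<integral>\<^sup>+z. ennreal (?f z) \<partial>edge_space E)"
      by (simp add: emeasure_density cong: nn_integral_cong)
    also have "\<dots> = ennreal (\<integral>z. ?f z \<partial>edge_space E)"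
      using w by (intro nn_integral_eq_integral int AE_I2) (auto simp: space_edge_space)
    finally show "emeasure (density (edge_space E) (\<lambda>z. ennreal (?f z)))
        (space (density (edge_space E) (\<lambda>z. ennreal (?f z)))) \<noteq> \<infinity>"
      by simp
  qed
  then show fin: "finite_measure (flux_lift E w)"
    unfolding flux_lift_def
    by (rule finite_measure.finite_measure_distr) (auto intro!: borel_measurable_Pair)
  interpret L: finite_measure "flux_lift E w" by (rule fin)
  have "measure (flux_lift E w) UNIV = integral\<^sup>L (flux_lift E w) (\<lambda>_. 1)"
    by (simp add: flux_lift_def)
  also have "\<dots> = (\<integral>z. ?f z \<partial>edge_space E)"
    using integral_flux_lift[OF E w, where \<Phi> = "\<lambda>_. 1"] by simp
  also have "\<dots> = (\<Sum>e\<in>E. \<integral>t. ?f (e, t) \<partial>unit_segment)"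
    by (rule integral_edge_space[OF E int])
  also have "\<dots> = (\<Sum>e\<in>E. w e * dist (fst e) (snd e))"
    by (simp add: U.prob_space)
  finally show "measure (flux_lift E w) UNIV = (\<Sum>e\<in>E. w e * dist (fst e) (snd e))" .
qed

text \<open>A flux is the first moment of its lift in the direction variable. With
  \<open>clip\<close> in place of the direction this moment is obtained by integrating functions
  that vanish at infinity, so it passes to weak-* limits of the lifts, and the limit is again the
  integral representation of a vector measure.\<close>

lemma flux_compactness:
  fixes E :: "nat \<Rightarrow> ('a::euclidean_space \<times> 'a) set"
  assumes E: "\<And>k. finite (E k)" and w: "\<And>k e. e \<in> E k \<Longrightarrow> 0 \<le> w k e"
    and ne: "\<And>k e. e \<in> E k \<Longrightarrow> fst e \<noteq> snd e"
    and bound: "\<And>k. (\<Sum>e\<in>E k. w k e * dist (fst e) (snd e)) \<le> C"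
  obtains r F where "strict_mono r" "is_rca F" "vec_wconv (\<lambda>k. graph_flux (E (r k)) (w (r k))) F"
proof -
  have fin: "finite_measure (flux_lift (E k) (w k))" for k by (intro flux_lift_mass E w)
  have sets: "sets (flux_lift (E k) (w k)) = sets borel" for k by (simp add: flux_lift_def)
  have mass: "measure (flux_lift (E k) (w k)) UNIV \<le> C" for k
    using bound[of k] flux_lift_mass(2)[OF E w] by simp
  obtain r Q where r: "strict_mono r" and Q: "finite_measure Q" and sQ: "sets Q = sets borel"
    and conv: "\<And>\<phi>. C0 \<phi> \<Longrightarrow> (\<lambda>k. integral\<^sup>L (flux_lift (E (r k)) (w (r k))) \<phi>) \<longlonglongrightarrow> integral\<^sup>L Q \<phi>"
    using weak_star_compact[of "\<lambda>k. flux_lift (E k) (w k)", OF fin sets mass] by blast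
  interpret Q: finite_measure Q by (rule Q)
  have m1: "fst \<in> borel_measurable Q"
    unfolding measurable_cong_sets[OF sQ refl]
    by (intro borel_measurable_continuous_onI continuous_intros)
  have m2: "(\<lambda>z. clip (snd z)) \<in> borel_measurable Q"
    unfolding measurable_cong_sets[OF sQ refl]
    by (intro borel_measurable_continuous_onI continuous_on_compose2[OF continuous_on_clip]
        continuous_intros) auto
  have clip_int: "integrable Q (\<lambda>z. clip (snd z))"
    by (rule Q.integrable_const_bound[where B = 2]) (auto simp: norm_clip m2)
  define F where "F B = (\<integral>z. indicator B (fst z) *\<^sub>R clip (snd z) \<partial>Q)" for B
  have "is_rca F"
    unfolding F_def by (rule is_rca_integral[OF m1 clip_int])
  moreover have "vec_wconv (\<lambda>k. graph_flux (E (r k)) (w (r k))) F"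
    unfolding vec_wconv_def
  proof (intro allI impI)
    fix \<phi> :: "'a \<Rightarrow> real" assume \<phi>: "C0 \<phi>"
    have lim: "vint F \<phi> \<bullet> b = (\<integral>z. \<phi> (fst z) * (clip (snd z) \<bullet> b) \<partial>Q)" for b
    proof -
      obtain K where K: "K > 0" "\<And>x. \<bar>\<phi> x\<bar> \<le> K" using C0_bounded[OF \<phi>] by blast
      have "vint F \<phi> = (\<integral>z. \<phi> (fst z) *\<^sub>R clip (snd z) \<partial>Q)"
        by (rule vint_eq_integral[OF Q m1 m2 norm_clip _ \<phi>]) (simp add: F_def)
      moreover have "integrable Q (\<lambda>z. \<phi> (fst z) *\<^sub>R clip (snd z))"
      proof (rule Q.integrable_const_bound[where B = "K * 2"])
        show "AE z in Q. norm (\<phi> (fst z) *\<^sub>R clip (snd z)) \<le> K * 2"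
          using K norm_clip by (intro AE_I2) (auto intro!: mult_mono simp: less_imp_le)
        show "(\<lambda>z. \<phi> (fst z) *\<^sub>R clip (snd z)) \<in> borel_measurable Q"
          using m2 measurable_compose[OF m1 C0_measurable[OF \<phi>]] by measurable
      qed
      ultimately show ?thesis by (simp flip: integral_inner_left)
    qed
    have seq: "vint (graph_flux (E k) (w k)) \<phi> \<bullet> b =
      integral\<^sup>L (flux_lift (E k) (w k)) (\<lambda>z. \<phi> (fst z) * (clip (snd z) \<bullet> b))" if b: "b \<in> Basis" for k b
    proof -
      let ?h = "\<lambda>z. \<phi> (edge_point z) *\<^sub>R (w k (fst z) *\<^sub>R (snd (fst z) - fst (fst z)))"
      interpret finite_measure "edge_space (E k)" using E by (rule finite_measure_edge_space)
      note [measurable] = measurable_edge_point[OF E] C0_measurable[OF \<phi>]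
      obtain K where K: "K > 0" "\<And>x. \<bar>\<phi> x\<bar> \<le> K" using C0_bounded[OF \<phi>] by blast
      have int: "integrable (edge_space (E k)) ?h"
      proof (rule integrable_const_bound[where B = "K * (\<Sum>e\<in>E k. norm (w k e *\<^sub>R (snd e - fst e)))"])
        have "(\<lambda>z. w k (fst z) *\<^sub>R (snd (fst z) - fst (fst z))) \<in> borel_measurable (edge_space (E k))"
          using measurable_edge_fun[OF E, of "\<lambda>e. w k e *\<^sub>R (snd e - fst e)"] .
        then show "?h \<in> borel_measurable (edge_space (E k))" by measurable
        show "AE z in edge_space (E k). norm (?h z) \<le> K * (\<Sum>e\<in>E k. norm (w k e *\<^sub>R (snd e - fst e)))"
        proof (rule AE_I2)
          fix z assume "z \<in> space (edge_space (E k))"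
          then have "fst z \<in> E k" by (auto simp: space_edge_space)
          then have "norm (w k (fst z) *\<^sub>R (snd (fst z) - fst (fst z))) \<le> (\<Sum>e\<in>E k. norm (w k e *\<^sub>R (snd e - fst e)))"
            using E by (intro member_le_sum[where f = "\<lambda>e. norm (w k e *\<^sub>R (snd e - fst e))"]) auto
          then have "\<bar>\<phi> (edge_point z)\<bar> * norm (w k (fst z) *\<^sub>R (snd (fst z) - fst (fst z))) \<le>
              K * (\<Sum>e\<in>E k. norm (w k e *\<^sub>R (snd e - fst e)))"
            using K by (intro mult_mono) (auto simp: less_imp_le)
          then show "norm (?h z) \<le> K * (\<Sum>e\<in>E k. norm (w k e *\<^sub>R (snd e - fst e)))"
            by (simp only: norm_scaleR)
        qed
      qed
      have "vint (graph_flux (E k) (w k)) \<phi> \<bullet> b = (\<integral>z. ?h z \<bullet> b \<partial>edge_space (E k))"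
        unfolding vint_graph_flux[OF E \<phi>] by (rule integral_inner_left[symmetric]) (rule int)
      \<comment> \<open>The length in the density of the lift cancels the normalisation of the
        direction. Edges are nondegenerate, so the direction has norm 1 and \<open>clip\<close>
        leaves it unchanged.\<close>
      also have "\<dots> = (\<integral>z. (w k (fst z) * dist (fst (fst z)) (snd (fst z))) *
          (\<phi> (edge_point z) * (clip (edge_direction (fst z)) \<bullet> b)) \<partial>edge_space (E k))"
      proof (intro Bochner_Integration.integral_cong refl)
        fix z assume "z \<in> space (edge_space (E k))"
        then have "fst (fst z) \<noteq> snd (fst z)" using ne by (auto simp: space_edge_space)
        then have d: "dist (fst (fst z)) (snd (fst z)) \<noteq> 0" by simp
        then have "norm (edge_direction (fst z)) = 1"
          by (simp add: edge_direction_def dist_norm norm_minus_commute)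
        then have "clip (edge_direction (fst z)) = edge_direction (fst z)" by (simp add: clip_unit)
        then show "?h z \<bullet> b = (w k (fst z) * dist (fst (fst z)) (snd (fst z))) *
          (\<phi> (edge_point z) * (clip (edge_direction (fst z)) \<bullet> b))"
          using d by (simp add: edge_direction_def)
      qed
      also have "\<dots> = integral\<^sup>L (flux_lift (E k) (w k)) (\<lambda>z. \<phi> (fst z) * (clip (snd z) \<bullet> b))"
        using integral_flux_lift[of "E k" "w k", OF E w C0_measurable[OF C0_clip[OF \<phi> b]]] by simp
      finally show ?thesis .
    qed
    show "(\<lambda>k. vint (graph_flux (E (r k)) (w (r k))) \<phi>) \<longlonglongrightarrow> vint F \<phi>"
      unfolding tendsto_componentwise_iff[of _ "vint F \<phi>"]
    proof
      fix b :: 'a assume b: "b \<in> Basis"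
      show "(\<lambda>k. vint (graph_flux (E (r k)) (w (r k))) \<phi> \<bullet> b) \<longlonglongrightarrow> vint F \<phi> \<bullet> b"
        unfolding lim seq[OF b] by (rule conv[OF C0_clip[OF \<phi> b]])
    qed
  qed
  ultimately show ?thesis using that r by blast
qed

section \<open>Diagonal selection and existence of minimizers\<close>

lemma C0_uniformly_continuous:
  fixes \<phi> :: "'a::euclidean_space \<Rightarrow> real"
  assumes "C0 \<phi>" "e > 0"
  obtains \<delta> where "\<delta> > 0" "\<And>x y. dist x y < \<delta> \<Longrightarrow> \<bar>\<phi> x - \<phi> y\<bar> \<le> e"
proof -
  obtain R where R: "\<And>x. R \<le> norm x \<Longrightarrow> \<bar>\<phi> x\<bar> \<le> e / 2"
    using assms unfolding C0_def by (meson half_gt_zero)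
  have "uniformly_continuous_on (cball 0 (R + 1)) \<phi>"
    by (intro compact_uniformly_continuous continuous_on_subset[OF C0_continuous[OF assms(1)]]) auto
  then obtain d where d: "d > 0" "\<And>x y. x \<in> cball 0 (R + 1) \<Longrightarrow> y \<in> cball 0 (R + 1) \<Longrightarrow>
      dist x y < d \<Longrightarrow> dist (\<phi> x) (\<phi> y) < e"
    unfolding uniformly_continuous_on_def using assms(2) by metis
  show ?thesis
  \<comment> \<open>With points less than 1 apart, as soon as one of them leaves the ball of radius
    \<open>R + 1\<close>, both have norm at least \<open>R\<close>, where \<open>\<phi>\<close> is
    small.\<close>
  proof (rule that[of "min d 1"])
    fix x y :: 'a assume xy: "dist x y < min d 1"
    show "\<bar>\<phi> x - \<phi> y\<bar> \<le> e"
    proof (cases "norm x \<le> R + 1 \<and> norm y \<le> R + 1")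
      case True
      then show ?thesis using d(2)[of x y] xy by (simp add: dist_real_def)
    next
      case False
      have "norm x \<le> norm y + dist x y" "norm y \<le> norm x + dist x y"
        by (metis dist_norm norm_triangle_sub, metis dist_commute dist_norm norm_triangle_sub)
      then have "R \<le> norm x" "R \<le> norm y" using False xy by auto
      then have "\<bar>\<phi> x\<bar> \<le> e / 2" "\<bar>\<phi> y\<bar> \<le> e / 2" using R by blast+
      then show ?thesis by linarith
    qed
  qed (use d in auto)
qed

text \<open>The functions are normalised tents of radius \<open>2 * \<epsilon>\<close> over an
  \<open>\<epsilon>\<close>-net. A point of the ball lies within \<open>\<epsilon>\<close> of some
  node, whose tent is at least \<open>\<epsilon>\<close> there.\<close>

lemma partition_of_unity_stage:
  fixes \<rho> \<epsilon> :: real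
  assumes "\<epsilon> > 0"
  obtains X :: "'a::euclidean_space set" and \<psi> :: "'a \<Rightarrow> 'a \<Rightarrow> real"
  where "finite X" "\<And>x. C0 (\<psi> x)" "\<And>x y. 0 \<le> \<psi> x y"
    "\<And>y. (\<Sum>x\<in>X. \<psi> x y) \<le> 1" "\<And>y. norm y \<le> \<rho> \<Longrightarrow> (\<Sum>x\<in>X. \<psi> x y) = 1"
    "\<And>x y. x \<in> X \<Longrightarrow> \<psi> x y \<noteq> 0 \<Longrightarrow> dist x y < 2 * \<epsilon> \<and> norm y \<le> \<rho> + 2 * \<epsilon>"
proof -
  have cov: "cball (0::'a) \<rho> \<subseteq> (\<Union>x\<in>cball 0 \<rho>. ball x \<epsilon>)" using assms by force
  obtain X where X: "X \<subseteq> cball 0 \<rho>" "finite X" "cball (0::'a) \<rho> \<subseteq> (\<Union>x\<in>X. ball x \<epsilon>)"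
    by (rule compactE_image[OF compact_cball _ cov]) auto
  define h where "h x y = max 0 (2 * \<epsilon> - dist x y)" for x y :: 'a
  define H where "H y = (\<Sum>x\<in>X. h x y)" for y
  \<comment> \<open>Dividing by \<open>max (H y) \<epsilon>\<close> instead of \<open>H y\<close>
    keeps the quotient continuous where all tents vanish, and changes nothing on the ball, where
    \<open>H y \<ge> \<epsilon>\<close>.\<close>
  define \<psi> where "\<psi> x y = h x y / max (H y) \<epsilon>" for x y
  have h0: "0 \<le> h x y" for x y by (simp add: h_def)
  have H0: "0 \<le> H y" for y unfolding H_def by (intro sum_nonneg h0)
  have pos: "max (H y) \<epsilon> > 0" for y using assms by auto
  have sum: "(\<Sum>x\<in>X. \<psi> x y) = H y / max (H y) \<epsilon>" for y
    by (simp add: \<psi>_def H_def sum_divide_distrib)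
  have near: "dist x y < 2 * \<epsilon>" if "\<psi> x y \<noteq> 0" for x y
    using that by (auto simp: \<psi>_def h_def max_def split: if_splits)
  show ?thesis
  proof (rule that[of X \<psi>])
    show "C0 (\<psi> x)" for x
    proof (rule C0_I_bounded_support[where R = "norm x + 2 * \<epsilon>"])
      show "continuous_on UNIV (\<psi> x)"
        unfolding \<psi>_def h_def H_def using pos by (intro continuous_intros) (auto simp: H_def h_def less_le)
      show "\<psi> x y = 0" if "norm x + 2 * \<epsilon> \<le> norm y" for y
      proof -
        have "norm y \<le> norm x + dist x y" by (metis dist_commute dist_norm norm_triangle_sub)
        then show ?thesis using near[of x y] that by linarith
      qed
    qed
    show "0 \<le> \<psi> x y" for x y using h0 pos[of y] by (simp add: \<psi>_def less_imp_le)
    show "(\<Sum>x\<in>X. \<psi> x y) \<le> 1" for y unfolding sum using pos[of y] by (simp add: divide_le_eq)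
    show "(\<Sum>x\<in>X. \<psi> x y) = 1" if "norm y \<le> \<rho>" for y
    proof -
      obtain x where x: "x \<in> X" "dist x y < \<epsilon>" using X(3) \<open>norm y \<le> \<rho>\<close> by (fastforce simp: subset_iff)
      then have "\<epsilon> \<le> h x y" by (simp add: h_def)
      also have "\<dots> \<le> H y" unfolding H_def using X(2) x(1) h0 by (intro member_le_sum) auto
      finally show ?thesis unfolding sum using assms by (simp add: max_def)
    qed
    show "dist x y < 2 * \<epsilon> \<and> norm y \<le> \<rho> + 2 * \<epsilon>" if "x \<in> X" "\<psi> x y \<noteq> 0" for x y
    proof -
      have "norm y \<le> norm x + dist x y" by (metis dist_commute dist_norm norm_triangle_sub)
      moreover have "norm x \<le> \<rho>" using X(1) that by auto
      ultimately show ?thesis using near[OF that(2)] by linarith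
    qed
  qed (rule X)
qed

text \<open>This replaces separability of the space of functions vanishing at infinity in the diagonal
  argument: each stage only involves finitely many test functions.\<close>

definition C0_tests :: "(nat \<Rightarrow> 'a::euclidean_space set) \<Rightarrow> (nat \<Rightarrow> 'a \<Rightarrow> 'a \<Rightarrow> real) \<Rightarrow> bool" where
  "C0_tests X \<psi> \<longleftrightarrow> (\<forall>i. finite (X i)) \<and> (\<forall>i x. C0 (\<psi> i x)) \<and>
     (\<forall>i x y. x \<in> X i \<longrightarrow> \<psi> i x y \<noteq> 0 \<longrightarrow> norm y \<le> 5 * real (Suc i)) \<and>
     (\<forall>\<phi> e. C0 \<phi> \<longrightarrow> e > 0 \<longrightarrow>
        (\<forall>\<^sub>F i in sequentially. \<forall>y. \<bar>\<phi> y - (\<Sum>x\<in>X i. \<phi> x * \<psi> i x y)\<bar> \<le> e))"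

text \<open>Stage \<open>i\<close> uses a net of mesh \<open>1 / (i + 1)\<close> in the ball of
  radius \<open>i + 1\<close>. Averaging the node values of \<open>\<phi>\<close> is accurate inside
  by uniform continuity, and outside because \<open>\<phi>\<close> is small there.\<close>

lemma ex_C0_tests: "\<exists>(X :: nat \<Rightarrow> 'a::euclidean_space set) \<psi>. C0_tests X \<psi>"
proof -
  define P where "P i X \<psi> \<longleftrightarrow> finite X \<and> (\<forall>x. C0 (\<psi> x)) \<and> (\<forall>x y. 0 \<le> \<psi> x y) \<and>
    (\<forall>y. (\<Sum>x\<in>X. \<psi> x y) \<le> 1) \<and> (\<forall>y. norm y \<le> real (Suc i) \<longrightarrow> (\<Sum>x\<in>X. \<psi> x y) = 1) \<and>
    (\<forall>x y. x \<in> X \<longrightarrow> \<psi> x y \<noteq> 0 \<longrightarrow> dist x y < 2 * (1 / real (Suc i)) \<and>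
      norm y \<le> real (Suc i) + 2 * (1 / real (Suc i)))"
    for i and X :: "'a set" and \<psi>
  have "\<exists>X \<psi>. P i X \<psi>" for i
  proof -
    show ?thesis
    proof (rule partition_of_unity_stage[of "1 / real (Suc i)" "real (Suc i)"])
      fix X :: "'a set" and \<psi>
      assume "finite X" "\<And>x. C0 (\<psi> x)" "\<And>x y. 0 \<le> \<psi> x y"
        "\<And>y. (\<Sum>x\<in>X. \<psi> x y) \<le> 1" "\<And>y. norm y \<le> real (Suc i) \<Longrightarrow> (\<Sum>x\<in>X. \<psi> x y) = 1"
        "\<And>x y. x \<in> X \<Longrightarrow> \<psi> x y \<noteq> 0 \<Longrightarrow>
          dist x y < 2 * (1 / real (Suc i)) \<and> norm y \<le> real (Suc i) + 2 * (1 / real (Suc i))"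
      then have "P i X \<psi>" unfolding P_def by blast
      then show ?thesis by blast
    qed simp
  qed
  then have "\<forall>i. \<exists>z. P i (fst z) (snd z)" by auto
  from choice[OF this] obtain z where z: "\<And>i. P i (fst (z i)) (snd (z i))" by blast
  define X \<psi> where "X i = fst (z i)" and "\<psi> i = snd (z i)" for i
  have P: "P i (X i) (\<psi> i)" for i using z[of i] by (simp add: X_def \<psi>_def)
  have "C0_tests X \<psi>"
    unfolding C0_tests_def
  proof (intro conjI allI impI)
    show "finite (X i)" "C0 (\<psi> i x)" for i x using P[of i] by (auto simp: P_def)
    show "norm y \<le> 5 * real (Suc i)" if "x \<in> X i" "\<psi> i x y \<noteq> 0" for i x y
    proof -
      \<comment> \<open>The support radius is at most \<open>3 * real (Suc i)\<close>. The bound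
        with factor 5 is the one needed later: beyond that radius the collapse acts.\<close>
      have "norm y \<le> real (Suc i) + 2 / real (Suc i)" using P[of i] that unfolding P_def by fastforce
      moreover have "2 / real (Suc i) \<le> 2" by (simp add: divide_le_eq)
      ultimately show ?thesis by simp
    qed
    fix \<phi> :: "'a \<Rightarrow> real" and e :: real assume \<phi>: "C0 \<phi>" and e: "e > 0"
    obtain \<delta> where \<delta>: "\<delta> > 0" "\<And>x y. dist x y < \<delta> \<Longrightarrow> \<bar>\<phi> x - \<phi> y\<bar> \<le> e / 2"
      using C0_uniformly_continuous[OF \<phi>, of "e / 2"] e by auto
    obtain R where R: "\<And>x. R \<le> norm x \<Longrightarrow> \<bar>\<phi> x\<bar> \<le> e / 2"
      using \<phi> e unfolding C0_def by (meson half_gt_zero)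
    have "\<forall>\<^sub>F i in sequentially. 2 / real (Suc i) < \<delta>"
    proof -
      have "(\<lambda>i. 2 / real (Suc i)) \<longlonglongrightarrow> 0" by (rule lim_const_over_n[THEN LIMSEQ_Suc])
      then show ?thesis using \<delta>(1) by (rule order_tendstoD(2))
    qed
    moreover have "\<forall>\<^sub>F i in sequentially. R \<le> real (Suc i)"
      using eventually_ge_at_top[of "nat \<lceil>R\<rceil>"] by eventually_elim linarith
    ultimately show "\<forall>\<^sub>F i in sequentially. \<forall>y. \<bar>\<phi> y - (\<Sum>x\<in>X i. \<phi> x * \<psi> i x y)\<bar> \<le> e"
    proof eventually_elim
      case (elim i)
      note Pi = P[of i, unfolded P_def]
      show ?case
      proof
        fix y
        let ?s = "\<Sum>x\<in>X i. \<psi> i x y"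
        have s: "0 \<le> ?s" "?s \<le> 1" using Pi by (auto intro: sum_nonneg)
        \<comment> \<open>The error is \<open>\<phi> y * (1 - ?s)\<close>, which vanishes inside the
          ball and is small outside, plus an average of \<open>\<phi> y - \<phi> x\<close> over
          nodes \<open>x\<close> close to \<open>y\<close>.\<close>
        have 1: "\<bar>\<phi> y * (1 - ?s)\<bar> \<le> e / 2"
        proof (cases "norm y \<le> real (Suc i)")
          case True
          then show ?thesis using Pi e by simp
        next
          case False
          then have "\<bar>\<phi> y\<bar> \<le> e / 2" using elim by (intro R) auto
          then have "\<bar>\<phi> y\<bar> * \<bar>1 - ?s\<bar> \<le> e / 2 * 1" using s e by (intro mult_mono) auto
          then show ?thesis by (simp add: abs_mult)
        qed
        have "\<bar>\<Sum>x\<in>X i. \<psi> i x y * (\<phi> y - \<phi> x)\<bar> \<le> (\<Sum>x\<in>X i. \<psi> i x y * (e / 2))"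
        proof (rule order_trans[OF sum_abs sum_mono])
          fix x assume x: "x \<in> X i"
          show "\<bar>\<psi> i x y * (\<phi> y - \<phi> x)\<bar> \<le> \<psi> i x y * (e / 2)"
          proof (cases "\<psi> i x y = 0")
            case False
            then have "dist x y < 2 * (1 / real (Suc i))" using Pi x by blast
            then have "dist y x < \<delta>" using elim(1) by (simp add: dist_commute)
            then have "\<bar>\<phi> y - \<phi> x\<bar> \<le> e / 2" by (rule \<delta>(2))
            moreover have "0 \<le> \<psi> i x y" using Pi by blast
            ultimately have "\<psi> i x y * \<bar>\<phi> y - \<phi> x\<bar> \<le> \<psi> i x y * (e / 2)" by (rule mult_left_mono)
            then show ?thesis using \<open>0 \<le> \<psi> i x y\<close> by (simp only: abs_mult abs_of_nonneg)
          qed simp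
        qed
        also have "\<dots> = ?s * (e / 2)" by (rule sum_distrib_right[symmetric])
        also have "\<dots> \<le> 1 * (e / 2)" using s e by (intro mult_right_mono) auto
        finally have 2: "\<bar>\<Sum>x\<in>X i. \<psi> i x y * (\<phi> y - \<phi> x)\<bar> \<le> e / 2" by simp
        have "\<phi> y - (\<Sum>x\<in>X i. \<phi> x * \<psi> i x y) = \<phi> y * (1 - ?s) + (\<Sum>x\<in>X i. \<psi> i x y * (\<phi> y - \<phi> x))"
          by (simp add: right_diff_distrib sum_subtractf sum_distrib_left sum_distrib_right algebra_simps)
        then show "\<bar>\<phi> y - (\<Sum>x\<in>X i. \<phi> x * \<psi> i x y)\<bar> \<le> e" using 1 2 by linarith
      qed
    qed
  qed
  then show ?thesis by blast
qed

section \<open>Cutoffs and closeness of masses at a finite stage\<close>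

definition ball_cutoff :: "nat \<Rightarrow> 'a::real_normed_vector \<Rightarrow> real" where
  "ball_cutoff i y = unit_ramp (5 * real (Suc i) + 1 - norm y)"

text \<open>It is 1 on the shell between the radii \<open>i + 1\<close> and
  \<open>5 * (i + 1)\<close>, where the collapsing map may move points that it does not send to the
  collapse point. It vanishes on the ball of radius \<open>i\<close>, so its integrals against a
  fixed finite measure tend to 0.\<close>

definition shell_cutoff :: "nat \<Rightarrow> 'a::real_normed_vector \<Rightarrow> real" where
  "shell_cutoff i y = unit_ramp (norm y - real i) * ball_cutoff i y"

lemma cutoff_bounds:
  "0 \<le> ball_cutoff i y" "ball_cutoff i y \<le> 1" "0 \<le> shell_cutoff i y" "shell_cutoff i y \<le> 1"
  by (auto simp: ball_cutoff_def shell_cutoff_def intro: mult_le_one)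

lemma C0_ball_cutoff: "C0 (ball_cutoff i :: 'a::euclidean_space \<Rightarrow> real)"
  by (rule C0_I_bounded_support[where R = "5 * real (Suc i) + 1"])
    (auto simp: ball_cutoff_def unit_ramp_eq_0 intro!: continuous_intros)

lemma C0_shell_cutoff: "C0 (shell_cutoff i :: 'a::euclidean_space \<Rightarrow> real)"
  by (rule C0_I_bounded_support[where R = "5 * real (Suc i) + 1"])
    (auto simp: shell_cutoff_def ball_cutoff_def unit_ramp_eq_0 intro!: continuous_intros)

lemma indicator_le_ball_cutoff: "indicator (cball 0 (5 * real (Suc i))) y \<le> ball_cutoff i y"
  by (auto simp: indicator_def ball_cutoff_def unit_ramp_eq_1)

lemma shell_cutoff_eq_1: "real (Suc i) \<le> norm y \<Longrightarrow> norm y \<le> 5 * real (Suc i) \<Longrightarrow> shell_cutoff i y = 1"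
  by (simp add: shell_cutoff_def ball_cutoff_def unit_ramp_eq_1)

lemma shell_cutoff_integral_tendsto_0:
  fixes \<mu> :: "'a::euclidean_space measure"
  assumes "finite_measure \<mu>" "sets \<mu> = sets borel"
  shows "(\<lambda>i. \<integral>y. shell_cutoff i y \<partial>\<mu>) \<longlonglongrightarrow> 0"
proof -
  interpret finite_measure \<mu> by fact
  have "(\<lambda>i. \<integral>y. shell_cutoff i y \<partial>\<mu>) \<longlonglongrightarrow> (\<integral>y. 0 \<partial>\<mu>)"
  proof (rule integral_dominated_convergence[where w = "\<lambda>_. 1"])
    show "shell_cutoff i \<in> borel_measurable \<mu>" for i
      using C0_measurable[OF C0_shell_cutoff] by (simp add: measurable_cong_sets[OF assms(2) refl])
    show "AE y in \<mu>. (\<lambda>i. shell_cutoff i y) \<longlonglongrightarrow> 0"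
    proof (rule AE_I2)
      fix y :: 'a
      have "\<forall>\<^sub>F i in sequentially. shell_cutoff i y = 0"
        using eventually_ge_at_top[of "nat \<lceil>norm y\<rceil>"]
        by eventually_elim (simp add: shell_cutoff_def unit_ramp_eq_0 nat_le_iff ceiling_le_iff)
      then show "(\<lambda>i. shell_cutoff i y) \<longlonglongrightarrow> 0" by (rule tendsto_eventually)
    qed
    show "AE y in \<mu>. norm (shell_cutoff i y) \<le> 1" for i
      by (intro AE_I2) (simp add: cutoff_bounds)
  qed auto
  then show ?thesis by simp
qed

lemma integral_le_measure:
  assumes "finite_measure \<mu>" "sets \<mu> = sets borel" "C0 \<phi>" "\<And>x. \<phi> x \<le> c"
  shows "(\<integral>x. \<phi> x \<partial>\<mu>) \<le> c * measure \<mu> UNIV"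
proof -
  interpret finite_measure \<mu> by fact
  have "(\<integral>x. \<phi> x \<partial>\<mu>) \<le> (\<integral>x. c \<partial>\<mu>)"
    by (rule integral_mono[OF C0_integrable[OF assms(3,1,2)]]) (auto simp: assms(4))
  then show ?thesis using sets_eq_imp_space_eq[OF assms(2)] by (simp add: mult.commute)
qed

lemma C0_combination:
  assumes "finite X" "\<And>x. C0 (\<psi> x)" shows "C0 (\<lambda>y. \<Sum>x\<in>X. c x * \<psi> x y)"
  unfolding C0_def
proof (intro conjI allI impI)
  show "continuous_on UNIV (\<lambda>y. \<Sum>x\<in>X. c x * \<psi> x y)"
    using C0_continuous[OF assms(2)] by (intro continuous_intros)
  fix e :: real assume e: "e > 0"
  define d where "d = e / (1 + (\<Sum>x\<in>X. \<bar>c x\<bar>))"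
  have pos: "1 + (\<Sum>x\<in>X. \<bar>c x\<bar>) > 0" by (simp add: add_pos_nonneg sum_nonneg)
  then have d: "d > 0" using e by (simp add: d_def)
  then have "\<forall>x. \<exists>R. \<forall>y. R \<le> norm y \<longrightarrow> \<bar>\<psi> x y\<bar> \<le> d" using assms(2) by (auto simp: C0_def)
  then obtain R where R: "\<And>x y. R x \<le> norm y \<Longrightarrow> \<bar>\<psi> x y\<bar> \<le> d" by metis
  have "\<bar>\<Sum>x\<in>X. c x * \<psi> x y\<bar> \<le> e" if y: "(\<Sum>x\<in>X. \<bar>R x\<bar>) \<le> norm y" for y
  proof -
    have "\<bar>\<Sum>x\<in>X. c x * \<psi> x y\<bar> \<le> (\<Sum>x\<in>X. \<bar>c x\<bar> * d)"
    proof (rule order_trans[OF sum_abs sum_mono])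
      fix x assume x: "x \<in> X"
      have "R x \<le> \<bar>R x\<bar>" by simp
      also have "\<dots> \<le> (\<Sum>x\<in>X. \<bar>R x\<bar>)" using assms(1) x by (intro member_le_sum) auto
      finally have "\<bar>\<psi> x y\<bar> \<le> d" using y by (intro R) auto
      then show "\<bar>c x * \<psi> x y\<bar> \<le> \<bar>c x\<bar> * d" by (simp add: abs_mult mult_left_mono)
    qed
    also have "\<dots> = (\<Sum>x\<in>X. \<bar>c x\<bar>) * d" by (rule sum_distrib_right[symmetric])
    also have "\<dots> \<le> (1 + (\<Sum>x\<in>X. \<bar>c x\<bar>)) * d" using d by (intro mult_right_mono) auto
    also have "\<dots> = e" using pos by (simp add: d_def)
    finally show ?thesis .
  qed
  then show "\<exists>R. \<forall>y. R \<le> norm y \<longrightarrow> \<bar>\<Sum>x\<in>X. c x * \<psi> x y\<bar> \<le> e" by blast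
qed

lemma mass_wconv_eventually_close:
  assumes "mass_wconv mk \<mu>" "C0 \<phi>" "e > 0"
  shows "\<forall>\<^sub>F k in sequentially. \<bar>msum (mk k) \<phi> - (\<integral>x. \<phi> x \<partial>\<mu>)\<bar> < e"
proof -
  have "(\<lambda>k. msum (mk k) \<phi>) \<longlonglongrightarrow> (\<integral>x. \<phi> x \<partial>\<mu>)"
    using assms by (simp add: mass_wconv_def msum_def)
  from tendstoD[OF this \<open>e > 0\<close>] show ?thesis by (simp add: dist_real_def)
qed

lemma tendsto_if_eventually_le_mult:
  fixes x :: "nat \<Rightarrow> real"
  assumes "C > 0" "\<And>e. e > 0 \<Longrightarrow> \<forall>\<^sub>F i in sequentially. \<bar>x i - l\<bar> \<le> C * e"
  shows "x \<longlonglongrightarrow> l"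
proof (rule tendstoI)
  fix e :: real assume "e > 0"
  then have "e / (2 * C) > 0" using assms(1) by simp
  from assms(2)[OF this] show "\<forall>\<^sub>F i in sequentially. dist (x i) l < e"
    by eventually_elim (use \<open>e > 0\<close> assms(1) in \<open>simp add: dist_real_def\<close>)
qed

text \<open>The three conditions bound the mass in the large ball, make the mass in the shell small,
  and control the approximating test functions. The tolerance is divided by the number of nodes
  because a test function combines one error per node; the successor of the cardinality avoids
  division by 0.\<close>

definition stage_close :: "(nat \<Rightarrow> 'a::euclidean_space set) \<Rightarrow> (nat \<Rightarrow> 'a \<Rightarrow> 'a \<Rightarrow> real) \<Rightarrow>
    nat \<Rightarrow> ('a \<Rightarrow> real) \<Rightarrow> 'a measure \<Rightarrow> bool" where
  "stage_close X \<psi> i m \<mu> \<longleftrightarrow>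
     \<bar>msum m (ball_cutoff i) - (\<integral>y. ball_cutoff i y \<partial>\<mu>)\<bar> < 1 \<and>
     \<bar>msum m (shell_cutoff i) - (\<integral>y. shell_cutoff i y \<partial>\<mu>)\<bar> < 1 / real (Suc i) \<and>
     (\<forall>x\<in>X i. \<bar>msum m (\<psi> i x) - (\<integral>y. \<psi> i x y \<partial>\<mu>)\<bar> < 1 / (real (Suc i) * real (Suc (card (X i)))))"

lemma eventually_stage_close:
  assumes "mass_wconv mk \<mu>" "C0_tests X \<psi>"
  shows "\<forall>\<^sub>F k in sequentially. stage_close X \<psi> i (mk k) \<mu>"
  unfolding stage_close_def using assms unfolding C0_tests_def
  by (intro eventually_conj eventually_ball_finite ballI mass_wconv_eventually_close
      C0_ball_cutoff C0_shell_cutoff) auto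

text \<open>The cutoff is a continuous majorant of the indicator that vanishes at infinity.
  Closeness therefore bounds the mass in the ball, while it says nothing about mass further
  out.\<close>

lemma stage_close_mass_bound:
  fixes m :: "'a::euclidean_space \<Rightarrow> real"
  assumes "stage_close X \<psi> i m \<mu>" "discrete_mass m" "finite_measure \<mu>" "sets \<mu> = sets borel"
  shows "msum m (indicator (cball 0 (5 * real (Suc i)))) \<le> measure \<mu> UNIV + 1"
proof -
  have "msum m (indicator (cball 0 (5 * real (Suc i)))) \<le> msum m (ball_cutoff i)"
    by (intro msum_mono assms indicator_le_ball_cutoff)
  also have "\<dots> \<le> (\<integral>y. ball_cutoff i y \<partial>\<mu>) + 1"
    using assms(1) by (auto simp: stage_close_def)
  also have "(\<integral>y. ball_cutoff i y \<partial>\<mu>) \<le> 1 * measure \<mu> UNIV"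
    by (intro integral_le_measure assms C0_ball_cutoff cutoff_bounds)
  finally show ?thesis by simp
qed

text \<open>Up to a lump of bounded mass at the point \<open>p i\<close>, which escapes to infinity, the collapsed
  masses agree asymptotically with the original ones on compact sets.\<close>

lemma collapsed_mass_wconv:
  fixes m m' :: "nat \<Rightarrow> 'a::euclidean_space \<Rightarrow> real" and X :: "nat \<Rightarrow> 'a set"
  assumes tests: "C0_tests X \<psi>" and \<mu>: "finite_measure \<mu>" "sets \<mu> = sets borel"
    and m: "\<And>i. discrete_mass (m i)" and close: "\<And>i. stage_close X \<psi> i (m i) \<mu>"
    and q: "\<And>i x. norm x \<le> real (Suc i) \<Longrightarrow> q i x = x"
    and p: "\<And>i. norm (p i) = real (Suc i)" and a: "\<And>i. 0 \<le> a i" "\<And>i. a i \<le> B"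
    and m': "\<And>i f. msum (m' i) f =
      msum (m i) (\<lambda>x. indicator (cball 0 (5 * real (Suc i))) x * f (q i x)) + a i * f (p i)"
  shows "mass_wconv m' \<mu>"
  unfolding mass_wconv_def msum_def[symmetric]
proof (intro allI impI)
  have X: "finite (X i)" and \<psi>: "C0 (\<psi> i x)" for i x using tests by (simp_all add: C0_tests_def)
  have supp: "norm y \<le> 5 * real (Suc i)" if "x \<in> X i" "\<psi> i x y \<noteq> 0" for i x y
    using tests that by (simp add: C0_tests_def)
  have approx: "\<forall>\<^sub>F i in sequentially. \<forall>y. \<bar>\<phi> y - (\<Sum>x\<in>X i. \<phi> x * \<psi> i x y)\<bar> \<le> e"
    if "C0 \<phi>" "e > 0" for \<phi> e
    using tests that by (simp add: C0_tests_def)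
  fix \<phi> :: "'a \<Rightarrow> real" assume \<phi>: "C0 \<phi>"
  interpret \<mu>: finite_measure \<mu> by (rule \<mu>)
  obtain K where K: "K > 0" "\<And>x. \<bar>\<phi> x\<bar> \<le> K" using C0_bounded[OF \<phi>] by blast
  define T where "T = measure \<mu> UNIV"
  have T0: "T \<ge> 0" by (simp add: T_def)
  have B0: "B \<ge> 0" using a[of 0] by linarith
  show "(\<lambda>i. msum (m' i) \<phi>) \<longlonglongrightarrow> (\<integral>x. \<phi> x \<partial>\<mu>)"
  proof (rule tendsto_if_eventually_le_mult)
    \<comment> \<open>The constant adds up the errors 1 to 5 below: \<open>4 * K\<close> for points
      moved in the shell, \<open>B\<close> for the lump, \<open>T + 1\<close> and \<open>T\<close>
      for approximating \<open>\<phi>\<close> on either side, and \<open>K\<close> for testing the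
      approximation.\<close>
    show "5 * K + B + 2 * T + 1 > 0" using K(1) T0 B0 by linarith
    fix e :: real assume e: "e > 0"
    obtain R where R: "\<And>x. R \<le> norm x \<Longrightarrow> \<bar>\<phi> x\<bar> \<le> e" using \<phi> e unfolding C0_def by blast
    have "\<forall>\<^sub>F i in sequentially. R \<le> real (Suc i)"
      using eventually_ge_at_top[of "nat \<lceil>R\<rceil>"] by eventually_elim linarith
    moreover have "\<forall>\<^sub>F i in sequentially. 1 / real (Suc i) < e"
      using lim_const_over_n[THEN LIMSEQ_Suc] e by (rule order_tendstoD(2))
    moreover have "\<forall>\<^sub>F i in sequentially. (\<integral>y. shell_cutoff i y \<partial>\<mu>) < e"
      using shell_cutoff_integral_tendsto_0[OF \<mu>] e by (rule order_tendstoD(2))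
    ultimately show "\<forall>\<^sub>F i in sequentially. \<bar>msum (m' i) \<phi> - (\<integral>x. \<phi> x \<partial>\<mu>)\<bar> \<le> (5 * K + B + 2 * T + 1) * e"
      using approx[OF \<phi> e]
    proof eventually_elim
      case (elim i)
      define S where "S = cball (0::'a) (5 * real (Suc i))"
      define \<phi>i where "\<phi>i y = (\<Sum>x\<in>X i. \<phi> x * \<psi> i x y)" for y
      have C\<phi>i: "C0 \<phi>i" unfolding \<phi>i_def[abs_def] by (intro C0_combination X \<psi>)
      note cl = close[of i, unfolded stage_close_def]
      have mS: "msum (m i) (indicator S) \<le> T + 1"
        unfolding S_def T_def by (rule stage_close_mass_bound[OF close m \<mu>])
      \<comment> \<open>Within \<open>S\<close> the map moves only points of norm above
        \<open>i + 1\<close>, where the shell cutoff is 1. Each unit of mass moved changes the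
        integral by at most \<open>2 * K\<close>, and the mass in the shell is below
        \<open>2 * e\<close>.\<close>
      have 1: "\<bar>msum (m i) (\<lambda>x. indicator S x * \<phi> (q i x)) - msum (m i) (\<lambda>x. indicator S x * \<phi> x)\<bar> \<le> 4 * K * e"
      proof -
        have "\<bar>msum (m i) (\<lambda>x. indicator S x * \<phi> (q i x) - indicator S x * \<phi> x)\<bar> \<le>
          msum (m i) (\<lambda>x. \<bar>indicator S x * \<phi> (q i x) - indicator S x * \<phi> x\<bar>)"
          by (rule abs_msum_le[OF m])
        also have "\<dots> \<le> msum (m i) (\<lambda>x. 2 * K * shell_cutoff i x)"
        proof (rule msum_mono[OF m])
          fix x
          have "\<bar>\<phi> (q i x) - \<phi> x\<bar> \<le> 2 * K" using K(2)[of x] K(2)[of "q i x"] by linarith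
          moreover have "0 \<le> 2 * K * shell_cutoff i x" using K(1) cutoff_bounds(3)[of i x] by simp
          ultimately show "\<bar>indicator S x * \<phi> (q i x) - indicator S x * \<phi> x\<bar> \<le> 2 * K * shell_cutoff i x"
            using q[of x i] shell_cutoff_eq_1[of i x]
            by (cases "norm x \<le> real (Suc i)"; cases "x \<in> S") (auto simp: S_def)
        qed
        also have "\<dots> = 2 * K * msum (m i) (shell_cutoff i)" by (rule msum_cmult)
        also have "\<dots> \<le> 2 * K * (2 * e)"
        proof (rule mult_left_mono)
          have "\<bar>msum (m i) (shell_cutoff i) - (\<integral>y. shell_cutoff i y \<partial>\<mu>)\<bar> < 1 / real (Suc i)"
            using cl by blast
          then show "msum (m i) (shell_cutoff i) \<le> 2 * e" using elim(2,3) by linarith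
        qed (use K(1) in simp)
        finally show ?thesis by (simp add: msum_diff)
      qed
      have 2: "\<bar>a i * \<phi> (p i)\<bar> \<le> B * e"
        using a[of i] elim(1) p[of i] B0 unfolding abs_mult by (intro mult_mono R) auto
      have 3: "\<bar>msum (m i) (\<lambda>x. indicator S x * \<phi> x) - msum (m i) \<phi>i\<bar> \<le> (T + 1) * e"
      proof -
        have out: "\<phi>i x = 0" if "x \<notin> S" for x
          unfolding \<phi>i_def using supp[of _ i x] that by (intro sum.neutral) (auto simp: S_def)
        have "\<bar>msum (m i) (\<lambda>x. indicator S x * \<phi> x - \<phi>i x)\<bar> \<le> msum (m i) (\<lambda>x. \<bar>indicator S x * \<phi> x - \<phi>i x\<bar>)"
          by (rule abs_msum_le[OF m])
        also have "\<dots> \<le> msum (m i) (\<lambda>x. e * indicator S x)"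
        proof (rule msum_mono[OF m])
          fix x show "\<bar>indicator S x * \<phi> x - \<phi>i x\<bar> \<le> e * indicator S x"
            using elim(4) out[of x] unfolding \<phi>i_def[symmetric] by (cases "x \<in> S") auto
        qed
        also have "\<dots> \<le> e * (T + 1)" unfolding msum_cmult using mS e by (intro mult_left_mono) auto
        finally show ?thesis by (simp add: msum_diff mult.commute)
      qed
      have 4: "\<bar>msum (m i) \<phi>i - (\<integral>x. \<phi>i x \<partial>\<mu>)\<bar> \<le> K * e"
      proof -
        let ?n = "real (Suc i) * real (Suc (card (X i)))"
        have "(\<integral>y. \<phi>i y \<partial>\<mu>) = (\<Sum>x\<in>X i. \<phi> x * (\<integral>y. \<psi> i x y \<partial>\<mu>))"
          unfolding \<phi>i_def using C0_integrable[OF \<psi> \<mu>]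
          by (subst Bochner_Integration.integral_sum) auto
        then have "msum (m i) \<phi>i - (\<integral>x. \<phi>i x \<partial>\<mu>) = (\<Sum>x\<in>X i. \<phi> x * (msum (m i) (\<psi> i x) - (\<integral>y. \<psi> i x y \<partial>\<mu>)))"
          unfolding \<phi>i_def by (simp add: msum_sum msum_cmult right_diff_distrib sum_subtractf)
        also have "\<bar>\<dots>\<bar> \<le> (\<Sum>x\<in>X i. K * (1 / ?n))"
        proof (rule order_trans[OF sum_abs sum_mono])
          fix x assume "x \<in> X i"
          then have "\<bar>msum (m i) (\<psi> i x) - (\<integral>y. \<psi> i x y \<partial>\<mu>)\<bar> \<le> 1 / ?n" using cl less_imp_le by blast
          then show "\<bar>\<phi> x * (msum (m i) (\<psi> i x) - (\<integral>y. \<psi> i x y \<partial>\<mu>))\<bar> \<le> K * (1 / ?n)"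
            unfolding abs_mult using K by (intro mult_mono) auto
        qed
        also have "\<dots> = K * (1 / real (Suc i)) * (real (card (X i)) / real (Suc (card (X i))))"
          by simp
        also have "\<dots> \<le> K * (1 / real (Suc i)) * 1"
          using K(1) by (intro mult_left_mono) auto
        also have "\<dots> \<le> K * e" using K(1) elim(2) by (simp only: mult_1_right) (intro mult_left_mono, auto)
        finally show ?thesis .
      qed
      have 5: "\<bar>(\<integral>x. \<phi>i x \<partial>\<mu>) - (\<integral>x. \<phi> x \<partial>\<mu>)\<bar> \<le> T * e"
      proof -
        have int: "integrable \<mu> \<phi>i" "integrable \<mu> \<phi>" by (intro C0_integrable C\<phi>i \<phi> \<mu>)+
        have "\<bar>\<integral>x. \<phi>i x - \<phi> x \<partial>\<mu>\<bar> \<le> (\<integral>x. \<bar>\<phi>i x - \<phi> x\<bar> \<partial>\<mu>)" by (rule integral_abs_bound)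
        also have "\<dots> \<le> (\<integral>x. e \<partial>\<mu>)"
        proof (rule integral_mono)
          show "\<bar>\<phi>i x - \<phi> x\<bar> \<le> e" for x using elim(4) by (simp add: \<phi>i_def abs_minus_commute)
        qed (use int in auto)
        also have "\<dots> = T * e" using sets_eq_imp_space_eq[OF \<mu>(2)] by (simp add: T_def)
        finally show ?thesis using int by simp
      qed
      have "\<bar>msum (m' i) \<phi> - (\<integral>x. \<phi> x \<partial>\<mu>)\<bar> \<le> 4 * K * e + B * e + (T + 1) * e + K * e + T * e"
        using 1 2 3 4 5 unfolding m' S_def[symmetric] by linarith
      then show ?case by (simp add: algebra_simps)
    qed
  qed
qed


section \<open>The direct method applied to a diagonal sequence of graphs\<close>

theorem mainTheorem1:
  fixes \<tau> :: "real \<Rightarrow> real" and \<mu>p \<mu>m :: "'a::euclidean_space measure"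
  assumes "transportation_cost \<tau>"
    and "sets \<mu>p = sets borel" and "sets \<mu>m = sets borel"
    and "finite_measure \<mu>p" and "finite_measure \<mu>m"
    and "bounded (spt \<mu>p)" and "bounded (spt \<mu>m)"
  shows "(\<exists>F. is_rca F \<and> (\<forall>G. is_rca G \<longrightarrow> Jfun \<tau> \<mu>p \<mu>m F \<le> Jfun \<tau> \<mu>p \<mu>m G))
         \<or> (\<forall>F. is_rca F \<longrightarrow> Jfun \<tau> \<mu>p \<mu>m F = \<infinity>)"
proof (rule disjCI)
  note \<tau> = assms(1) and \<mu>p = assms(4,2) and \<mu>m = assms(5,3)
  note \<tau>D = transportation_costD[OF \<tau>]
  let ?J = "Jfun \<tau> \<mu>p \<mu>m"
  assume "\<not> (\<forall>F. is_rca F \<longrightarrow> ?J F = \<infinity>)"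
  then obtain F0 where F0: "is_rca F0" "?J F0 \<noteq> \<infinity>" by blast
  define c where "c = (INF F\<in>{F. is_rca F}. ?J F)"
  have c_le: "c \<le> ?J G" if "is_rca G" for G
    unfolding c_def using that by (intro INF_lower) simp
  have cost_nonneg: "0 \<le> graph_cost \<tau> E w" if "mass_flux mp mm V E w"
    for mp mm :: "'a \<Rightarrow> real" and V E w
    unfolding graph_cost_def using mass_fluxD(5)[OF that] \<tau>D(2) by (intro sum_nonneg mult_nonneg_nonneg) auto
  have "0 \<le> ?J F" for F
    unfolding Jfun_def
  proof (rule Inf_greatest, clarify)
    fix mp mm :: "nat \<Rightarrow> 'a \<Rightarrow> real" and V E w
    assume "\<forall>k. mass_flux (mp k) (mm k) (V k) (E k) (w k)"
    then have "0 \<le> graph_cost \<tau> (E k) (w k)" for k using cost_nonneg by blast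
    then show "0 \<le> liminf (\<lambda>k. ereal (graph_cost \<tau> (E k) (w k)))"
      by (intro Liminf_bounded always_eventually allI) simp
  qed
  then have "0 \<le> c" unfolding c_def by (intro INF_greatest)
  moreover have "c < \<infinity>" using c_le[OF F0(1)] F0(2) by (auto simp: less_top[symmetric] top_unique)
  ultimately obtain c0 where c0: "c = ereal c0" "0 \<le> c0" by (cases c) auto
  obtain X :: "nat \<Rightarrow> 'a set" and \<psi> where tests: "C0_tests X \<psi>"
    using ex_C0_tests by blast
  have stage: "\<exists>mp mm V E w. mass_flux mp mm V E w \<and> graph_cost \<tau> E w < c0 + 1 / real (Suc i) \<and>
      stage_close X \<psi> i mp \<mu>p \<and> stage_close X \<psi> i mm \<mu>m" for i
  proof -
    have "c < ereal (c0 + 1 / real (Suc i))" using c0 by simp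
    then obtain F where "?J F < ereal (c0 + 1 / real (Suc i))"
      unfolding c_def INF_less_iff by blast
    then obtain mp mm V E w where flux: "\<And>k. mass_flux (mp k) (mm k) (V k) (E k) (w k)"
      and conv: "mass_wconv mp \<mu>p" "mass_wconv mm \<mu>m"
      and liminf: "liminf (\<lambda>k. ereal (graph_cost \<tau> (E k) (w k))) < ereal (c0 + 1 / real (Suc i))"
      unfolding Jfun_def Inf_less_iff by blast
    \<comment> \<open>A liminf below the threshold gives infinitely many cheap graphs, while
      closeness holds for almost all indices, so some graph has both properties.\<close>
    have "\<exists>\<^sub>F k in sequentially. graph_cost \<tau> (E k) (w k) < c0 + 1 / real (Suc i)"
    proof (rule ccontr)
      assume "\<not> (\<exists>\<^sub>F k in sequentially. graph_cost \<tau> (E k) (w k) < c0 + 1 / real (Suc i))"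
      then have "\<forall>\<^sub>F k in sequentially. ereal (c0 + 1 / real (Suc i)) \<le> ereal (graph_cost \<tau> (E k) (w k))"
        by (simp add: not_frequently not_less)
      then have "ereal (c0 + 1 / real (Suc i)) \<le> liminf (\<lambda>k. ereal (graph_cost \<tau> (E k) (w k)))"
        by (rule Liminf_bounded)
      then show False using liminf by simp
    qed
    moreover have "\<forall>\<^sub>F k in sequentially. stage_close X \<psi> i (mp k) \<mu>p \<and> stage_close X \<psi> i (mm k) \<mu>m"
      by (intro eventually_conj eventually_stage_close conv tests)
    ultimately have "\<exists>\<^sub>F k in sequentially. graph_cost \<tau> (E k) (w k) < c0 + 1 / real (Suc i) \<and>
        stage_close X \<psi> i (mp k) \<mu>p \<and> stage_close X \<psi> i (mm k) \<mu>m"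
      by (rule frequently_eventually_frequently)
    from frequently_ex[OF this] show ?thesis using flux by blast
  qed
  define b0 :: 'a where "b0 = (SOME b. b \<in> Basis)"
  have b0: "norm b0 = 1" unfolding b0_def using nonempty_Basis some_in_eq norm_Basis by metis
  \<comment> \<open>Points of norm at most \<open>i + 1\<close> lie within
    \<open>2 * (i + 1)\<close> of \<open>p i\<close>, where the fold of that radius is the identity.
    Points of norm above \<open>5 * (i + 1)\<close> lie at distance more than
    \<open>4 * (i + 1)\<close> from \<open>p i\<close>, where the fold is constant. This is the
    origin of the factor 5 throughout.\<close>
  define p where "p i = real (Suc i) *\<^sub>R b0" for i
  define q where "q i = fold_map (2 * real (Suc i)) (p i)" for i
  have p: "norm (p i) = real (Suc i)" for i by (simp add: p_def b0)
  have q_id: "q i x = x" if "norm x \<le> real (Suc i)" for i x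
  proof -
    have "dist x (p i) \<le> norm x + norm (p i)" by (simp add: dist_norm norm_triangle_ineq4)
    then show ?thesis unfolding q_def using that p[of i] by (intro fold_map_inside) simp
  qed
  have q_out: "q i x = p i" if "x \<notin> cball 0 (5 * real (Suc i))" for i x
  proof -
    have "norm x \<le> dist x (p i) + norm (p i)" by (metis add.commute dist_norm norm_triangle_sub)
    then show ?thesis unfolding q_def using that p[of i] by (intro fold_map_outside) auto
  qed
  have q_lip: "dist (q i x) (q i y) \<le> dist x y" for i x y
    unfolding q_def by (rule fold_map_nonexpansive) simp
  \<comment> \<open>The mass of source and sink inside the ball exceeds that of the limit measure by
    at most 1 each; hence the 2.\<close>
  define M where "M = measure \<mu>p UNIV + measure \<mu>m UNIV + 2"
  have M: "M > 0" by (simp add: M_def add_nonneg_pos)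
  define collapse where "collapse i \<mu> m' m a \<longleftrightarrow> discrete_mass m \<and> stage_close X \<psi> i m \<mu> \<and> 0 \<le> a \<and> a \<le> M \<and>
     (\<forall>f. msum m' f = msum m (\<lambda>x. indicator (cball 0 (5 * real (Suc i))) x * f (q i x)) + a * f (p i))"
    for i \<mu> m' m and a :: real
  define collapsed where "collapsed i \<mu> m' \<longleftrightarrow> (\<exists>m a. collapse i \<mu> m' m a)" for i \<mu> m'
  have collapsed_conv: "mass_wconv m' \<mu>" if "\<And>i. collapsed i \<mu> (m' i)" "finite_measure \<mu>" "sets \<mu> = sets borel"
    for \<mu> m'
  proof -
    have "\<forall>i. \<exists>z. collapse i \<mu> (m' i) (fst z) (snd z)" using that(1) by (auto simp: collapsed_def)
    from choice[OF this] obtain z where z: "\<And>i. collapse i \<mu> (m' i) (fst (z i)) (snd (z i))" by blast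
    show ?thesis
    proof (rule collapsed_mass_wconv[where q = q and p = p and m = "\<lambda>i. fst (z i)" and a = "\<lambda>i. snd (z i)" and B = M])
      show "discrete_mass (fst (z i))" "stage_close X \<psi> i (fst (z i)) \<mu>" "0 \<le> snd (z i)" "snd (z i) \<le> M" for i
        using z[of i] by (simp_all add: collapse_def)
      show "msum (m' i) f = msum (fst (z i)) (\<lambda>x. indicator (cball 0 (5 * real (Suc i))) x * f (q i x)) +
          snd (z i) * f (p i)" for i f
        using z[of i] unfolding collapse_def by blast
    qed (rule tests that(2,3) q_id p | assumption)+
  qed
  define good where "good i mp mm V E w \<longleftrightarrow> mass_flux mp mm V E w \<and> graph_cost \<tau> E w \<le> c0 + 1 / real (Suc i) \<and>
    (\<forall>e\<in>E. w e \<le> 2 * M) \<and> collapsed i \<mu>p mp \<and> collapsed i \<mu>m mm" for i mp mm V E w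
  have "\<exists>mp mm V E w. good i mp mm V E w" for i
  proof -
    obtain mp mm V E w where flux: "mass_flux mp mm V E w"
      and cost: "graph_cost \<tau> E w < c0 + 1 / real (Suc i)"
      and close: "stage_close X \<psi> i mp \<mu>p" "stage_close X \<psi> i mm \<mu>m"
      using stage[of i] by blast
    note D = mass_fluxD[OF flux]
    let ?S = "cball 0 (5 * real (Suc i)) :: 'a set"
    have B: "msum mp (indicator ?S) + msum mm (indicator ?S) \<le> M"
      using stage_close_mass_bound[OF close(1) D(1) \<mu>p] stage_close_mass_bound[OF close(2) D(2) \<mu>m]
      by (simp add: M_def)
    show ?thesis
    proof (rule mass_flux_collapse[OF flux \<tau> q_lip[of i] q_out[of _ i]])
      fix mp' mm' :: "'a \<Rightarrow> real" and V' E' w' ap am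
      assume flux': "mass_flux mp' mm' V' E' w'"
        and cost': "graph_cost \<tau> E' w' \<le> graph_cost \<tau> E w"
        and w': "\<And>e. e \<in> E' \<Longrightarrow> w' e \<le> 2 * (msum mp (indicator ?S) + msum mm (indicator ?S))"
        and ap: "0 \<le> ap" "ap \<le> msum mp (indicator ?S) + msum mm (indicator ?S)"
        and am: "0 \<le> am" "am \<le> msum mp (indicator ?S) + msum mm (indicator ?S)"
        and mp': "\<And>f. msum mp' f = msum mp (\<lambda>x. indicator ?S x * f (q i x)) + ap * f (p i)"
        and mm': "\<And>f. msum mm' f = msum mm (\<lambda>x. indicator ?S x * f (q i x)) + am * f (p i)"
      have "collapse i \<mu>p mp' mp ap"
        unfolding collapse_def using D(1) close(1) ap B mp' by auto
      moreover have "collapse i \<mu>m mm' mm am"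
        unfolding collapse_def using D(2) close(2) am B mm' by auto
      moreover have "w' e \<le> 2 * M" if "e \<in> E'" for e
        using order_trans[OF w'[OF that] mult_left_mono[OF B, of 2]] by simp
      ultimately have "good i mp' mm' V' E' w'"
        unfolding good_def collapsed_def using flux' cost' cost by auto
      then show ?thesis by blast
    qed
  qed
  then obtain mp mm V E w where good: "\<And>i. good i (mp i) (mm i) (V i) (E i) (w i)" by metis
  have flux: "mass_flux (mp i) (mm i) (V i) (E i) (w i)" and cost: "graph_cost \<tau> (E i) (w i) \<le> c0 + 1 / real (Suc i)"
    and wM: "\<And>e. e \<in> E i \<Longrightarrow> w i e \<le> 2 * M" and col: "collapsed i \<mu>p (mp i)" "collapsed i \<mu>m (mm i)" for i
    using good[of i] by (auto simp: good_def)
  note D = mass_fluxD[OF flux]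
  \<comment> \<open>All weights at all stages lie in [0, 2M], so one slope serves for the whole
    sequence and turns the cost bound into a bound on the total variations.\<close>
  obtain l where l: "l > 0" "\<And>u. 0 \<le> u \<Longrightarrow> u \<le> 2 * M \<Longrightarrow> l * u \<le> \<tau> u"
    using transportation_cost_linear_lower_bound[OF \<tau>, of "2 * M"] M by auto
  have "(\<Sum>e\<in>E i. w i e * dist (fst e) (snd e)) \<le> (c0 + 1) / l" for i
  proof -
    have "l * (\<Sum>e\<in>E i. w i e * dist (fst e) (snd e)) = (\<Sum>e\<in>E i. l * w i e * dist (fst e) (snd e))"
      by (simp add: sum_distrib_left mult.assoc)
    also have "\<dots> \<le> graph_cost \<tau> (E i) (w i)"
      unfolding graph_cost_def using D(5) wM l(2) by (intro sum_mono mult_right_mono) auto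
    also have "\<dots> \<le> c0 + 1 / real (Suc i)" by (rule cost)
    also have "\<dots> \<le> c0 + 1" by simp
    finally show ?thesis using l(1) by (simp add: pos_le_divide_eq mult.commute)
  qed
  then obtain r F where r: "strict_mono r" and F: "is_rca F"
    and Fconv: "vec_wconv (\<lambda>k. graph_flux (E (r k)) (w (r k))) F"
    using flux_compactness[of E w "(c0 + 1) / l"] D(4,5,6) by blast
  have sub: "mass_wconv (\<lambda>k. m (r k)) \<mu>" if "mass_wconv m \<mu>" for m and \<mu> :: "'a measure"
    using that LIMSEQ_subseq_LIMSEQ[OF _ r] unfolding mass_wconv_def by (fastforce simp: o_def)
  \<comment> \<open>The selected graphs themselves form an approximating sequence for
    \<open>F\<close>, since the collapsed masses still converge to \<open>\<mu>p\<close> and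
    \<open>\<mu>m\<close>. Their costs, at most \<open>c0 + 1 / (i + 1)\<close> at stage
    \<open>i\<close>, therefore bound \<open>?J F\<close> directly.\<close>
  have "?J F \<le> liminf (\<lambda>k. ereal (graph_cost \<tau> (E (r k)) (w (r k))))"
    unfolding Jfun_def
  proof (rule Inf_lower, intro CollectI exI conjI allI)
    show "mass_flux (mp (r k)) (mm (r k)) (V (r k)) (E (r k)) (w (r k))" for k by (rule flux)
    show "mass_wconv (\<lambda>k. mp (r k)) \<mu>p" "mass_wconv (\<lambda>k. mm (r k)) \<mu>m"
      by (intro sub collapsed_conv col \<mu>p \<mu>m)+
  qed (rule refl Fconv)+
  also have "\<dots> \<le> liminf (\<lambda>k. ereal (c0 + 1 / real (Suc (r k))))"
    using cost by (intro Liminf_mono always_eventually allI) simp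
  also have "\<dots> = ereal c0"
  proof (rule lim_imp_Liminf)
    have "(\<lambda>i. 1 / real (Suc i)) \<longlonglongrightarrow> 0" by (rule lim_const_over_n[THEN LIMSEQ_Suc])
    from LIMSEQ_subseq_LIMSEQ[OF this r]
    have "(\<lambda>k. c0 + 1 / real (Suc (r k))) \<longlonglongrightarrow> c0 + 0" by (intro tendsto_intros) (simp add: o_def)
    then show "(\<lambda>k. ereal (c0 + 1 / real (Suc (r k)))) \<longlonglongrightarrow> ereal c0" by simp
  qed simp
  finally have "?J F \<le> c" by (simp add: c0)
  then show "\<exists>F. is_rca F \<and> (\<forall>G. is_rca G \<longrightarrow> ?J F \<le> ?J G)"
    using F c_le order_trans by blast
qed

end
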